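(* Let $(\mathbb{X},\mathbb{U},\mathcal{T},c)$ be a Markov decision process with $\mathbb{X}\subset\mathbb{R}^n$ Borel such that: (A1) $\mathbb{U}$ is compact (and finite); $c:\mathbb{X}\times\mathbb{U}\to\mathbb{R}$ is nonnegative, bounded and continuous; $\mathcal{T}$ is weak Feller, i.e. $(x,u)\mapsto\int g(x_1)\,\mathcal{T}(dx_1|x,u)$ is continuous for every bounded continuous $g:\mathbb{X}\to\mathbb{R}$; (A2) there are constants $\alpha_c,\alpha_T>0$ such that for all $x,x'\in\mathbb{X}$, $u\in\mathbb{U}$: $|c(x,u)-c(x',u)|\le\alpha_c\|x-x'\|_1$ and $\|\mathcal{T}(\cdot|x,u)-\mathcal{T}(\cdot|x',u)\|_{TV}\le\alpha_T\|x-x'\|_1$; (A3) (minorization) there is a non-trivial positive measure $\mu$ on $\mathbb{X}$ such that $\mathcal{T}(B|x,u)\ge\mu(B)$ for all $(x,u)\in\mathbb{X}\times\mathbb{U}$ and all Borel $B\subseteq\mathbb{X}$. Let $\{B_i\}_{i=1}^M$ be a measurable partition of $\mathbb{X}$, $\pi$ a probability measure on $\mathbb{X}$ with $\pi(B_i)>0$ for all $i$, and consider the associated finite model, its optimal average cost $\hat J_{avg}$, the relative value functions $h,\hat h$ and the loss function $L$ as defined in the context. Then $J^*_{avg}(x)$ and $\hat J_{avg}(x)$ are constant in $x$: there are constants $j^*,\hat j$ with $J^*_{avg}(x)=j^*$ and $\hat J_{avg}(x)=\hat j$ for all $x\in\mathbb{X}$. Moreover, for every $x_0\in\mathbb{X}$,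 $$\left|J^*_{avg}(x_0)-\hat J_{avg}(x_0)\right|\le\left(\alpha_c+\frac{\alpha_T\|c\|_\infty}{\mu(\mathbb{X})}\right)\int_{\mathbb{X}}L(x)\,\pi_{\gamma_s}(dx),$$ where $\gamma_s$ is the stationary policy which at each $x$ applies an action achieving the supremum in $\sup_{u\in\mathbb{U}}\int|h(x_1)-\hat h(x_1)|\,\mathcal{T}(dx_1|x,u)$, and $\pi_{\gamma_s}$ is the invariant probability measure of the state process under $\gamma_s$.
   Context: MDP: $\mathcal{T}(\cdot|x,u)$ is a stochastic kernel from $\mathbb{X}\times\mathbb{U}$ to $\mathbb{X}$. An admissible policy $\gamma=\{\gamma_t\}$ chooses $U_t=\gamma_t(X_0,\dots,X_t,U_0,\dots,U_{t-1})$ measurably; a stationary policy is given by a measurable $f:\mathbb{X}\to\mathbb{U}$ with $U_t=f(X_t)$ for all $t$. $J_{avg}(x,\gamma)=\limsup_{T\to\infty}\frac1T\mathbb{E}^\gamma_x[\sum_{t=0}^{T-1}c(X_t,U_t)]$ and $J^*_{avg}(x)=\inf_\gamma J_{avg}(x,\gamma)$ over admissible $\gamma$. Finite model: each bin $B_i$ has a representative $y_i\in B_i$; $\mathbb{Y}=\{y_1,\dots,y_M\}$; $q(x)=y_i$ for $x\in B_i$. The weighting measures are $\hat\pi_{y_i}(A)=\pi(A)/\pi(B_i)$ for measurable $A\subseteq B_i$. Set $C^*(y_i,u)=\int_{B_i}c(x,u)\,\hat\pi_{y_i}(dx)$ and $P^*(y_j|y_i,u)=\int_{B_i}\mathcal{T}(B_j|x,u)\,\hat\pi_{y_i}(dx)$.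 $\hat J_{avg}(x)$ is the optimal infinite-horizon average cost of the finite MDP $(\mathbb{Y},\mathbb{U},P^*,C^* )$ started from $q(x)$. Relative value functions: $h:\mathbb{X}\to\mathbb{R}$ and $\hat h:\mathbb{Y}\to\mathbb{R}$ are the (bounded) solutions, whose existence is guaranteed under (A3), of $$h(x)=\inf_{u\in\mathbb{U}}\Big\{c(x,u)+\int_{\mathbb{X}}h(x_1)\,\mathcal{T}(dx_1|x,u)\Big\}-\int_{\mathbb{X}}h\,d\mu,$$ $$\hat h(y)=\inf_{u\in\mathbb{U}}\Big\{C^*(y,u)+\sum_{y_1\in\mathbb{Y}}\hat h(y_1)P^*(y_1|y,u)\Big\}-\int_{\mathbb{X}}\hat h(q(x))\,\mu(dx),$$ and $\hat h$ is extended to $\mathbb{X}$ by $\hat h(x)=\hat h(q(x))$. Loss function: $L(x)=\int_{B_i}\|x-x'\|_1\,\hat\pi_{y_i}(dx')$ for $x\in B_i$ (values in $[0,\infty]$), with $\|\cdot\|_1$ the $\ell_1$ norm on $\mathbb{R}^n$. The right-hand side of the bound may be $+\infty$. Total variation convention: $\|\mu-\nu\|_{TV}=\sup_{\|f\|_\infty\le1}|\int f\,d\mu-\int f\,d\nu|$. *)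

theory Defs
  imports "HOL-Probability.Probability"
begin

section \<open>Norms\<close>

definition l1_norm :: "real ^ 'n \<Rightarrow> real" where
  "l1_norm x = (\<Sum>i\<in>UNIV. \<bar>x $ i\<bar>)"

text \<open>Test functions are bounded by 1 (not by 1/2), so two mutually singular probability
  measures are at distance 2.\<close>

definition tv_norm :: "'a measure \<Rightarrow> 'a measure \<Rightarrow> ennreal" where
  "tv_norm M N = (SUP f \<in> {f \<in> borel_measurable M. \<forall>x\<in>space M. \<bar>f x\<bar> \<le> (1::real)}.
     ennreal \<bar>(\<integral>x. f x \<partial>M) - (\<integral>x. f x \<partial>N)\<bar>)"

abbreviation borel_on :: "'a::topological_space set \<Rightarrow> 'a measure" where
  "borel_on X \<equiv> restrict_space borel X"

section \<open>Markov decision processes\<close>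

text \<open>Throughout, \<open>S\<close> and \<open>A\<close> are the measurable spaces of states and actions.
  At time \<open>t\<close> a policy sees the past pairs
  \<open>h s = (X\<^sub>s, U\<^sub>s)\<close> for \<open>s < t\<close> and the current state \<open>X\<^sub>t\<close>.\<close>

type_synonym ('x, 'u) policy = "nat \<Rightarrow> (nat \<Rightarrow> 'x \<times> 'u) \<Rightarrow> 'x \<Rightarrow> 'u"

definition admissible :: "'x measure \<Rightarrow> 'u measure \<Rightarrow> ('x, 'u) policy \<Rightarrow> bool" where
  "admissible S A \<gamma> \<longleftrightarrow>
     (\<forall>t. (\<lambda>(h, x). \<gamma> t h x) \<in> (\<Pi>\<^sub>M s\<in>{0..<t}. S \<Otimes>\<^sub>M A) \<Otimes>\<^sub>M S \<rightarrow>\<^sub>M A)"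

text \<open>The conditional law of \<open>(X\<^sub>t, U\<^sub>t)\<close> given the past pairs.\<close>

definition pair_kernel ::
  "'x measure \<Rightarrow> 'u measure \<Rightarrow> ('x \<Rightarrow> 'u \<Rightarrow> 'x measure) \<Rightarrow> ('x, 'u) policy \<Rightarrow> 'x
    \<Rightarrow> nat \<Rightarrow> (nat \<Rightarrow> 'x \<times> 'u) \<Rightarrow> ('x \<times> 'u) measure" where
  "pair_kernel S A T \<gamma> x\<^sub>0 t h =
     distr (if t = 0 then return S x\<^sub>0 else T (fst (h (t - 1))) (snd (h (t - 1))))
       (S \<Otimes>\<^sub>M A) (\<lambda>x. (x, \<gamma> t h x))"

text \<open>Law of the whole state-action process started in \<open>x\<^sub>0\<close>: the
  projective limit given by the Ionescu-Tulcea theorem.\<close>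

definition process_law ::
  "'x measure \<Rightarrow> 'u measure \<Rightarrow> ('x \<Rightarrow> 'u \<Rightarrow> 'x measure) \<Rightarrow> ('x, 'u) policy \<Rightarrow> 'x
    \<Rightarrow> (nat \<Rightarrow> 'x \<times> 'u) measure" where
  "process_law S A T \<gamma> x\<^sub>0 =
     projective_family.lim UNIV
       (Ionescu_Tulcea.CI (pair_kernel S A T \<gamma> x\<^sub>0) (\<lambda>_. S \<Otimes>\<^sub>M A)) (\<lambda>_. S \<Otimes>\<^sub>M A)"

definition avg_cost ::
  "'x measure \<Rightarrow> 'u measure \<Rightarrow> ('x \<Rightarrow> 'u \<Rightarrow> 'x measure) \<Rightarrow> ('x \<Rightarrow> 'u \<Rightarrow> real)
    \<Rightarrow> 'x \<Rightarrow> ('x, 'u) policy \<Rightarrow> ereal" where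
  "avg_cost S A T c x\<^sub>0 \<gamma> = limsup (\<lambda>n. ereal (1 / real n *
     (\<integral>\<omega>. (\<Sum>t<n. c (fst (\<omega> t)) (snd (\<omega> t))) \<partial>process_law S A T \<gamma> x\<^sub>0)))"

definition opt_avg_cost ::
  "'x measure \<Rightarrow> 'u measure \<Rightarrow> ('x \<Rightarrow> 'u \<Rightarrow> 'x measure) \<Rightarrow> ('x \<Rightarrow> 'u \<Rightarrow> real) \<Rightarrow> 'x \<Rightarrow> ereal" where
  "opt_avg_cost S A T c x\<^sub>0 = (INF \<gamma> \<in> {\<gamma>. admissible S A \<gamma>}. avg_cost S A T c x\<^sub>0 \<gamma>)"

definition invariant_prob ::
  "'x measure \<Rightarrow> ('x \<Rightarrow> 'u \<Rightarrow> 'x measure) \<Rightarrow> ('x \<Rightarrow> 'u) \<Rightarrow> 'x measure \<Rightarrow> bool" where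
  "invariant_prob S T f \<rho> \<longleftrightarrow> sets \<rho> = sets S \<and> prob_space \<rho> \<and>
     (\<forall>D\<in>sets S. emeasure \<rho> D = (\<integral>\<^sup>+x. emeasure (T x (f x)) D \<partial>\<rho>))"

section \<open>The finite model\<close>

text \<open>\<open>B 1, \<dots>, B M\<close> are the bins and \<open>y i\<close> represents \<open>B i\<close>. The quantities that are
  indexed by \<open>y i\<close> are defined at every point \<open>z\<close> of the state space, through the bin
  containing \<open>z\<close>; for \<open>z = y i\<close> that bin is \<open>B i\<close>.\<close>

definition bin_index :: "nat \<Rightarrow> (nat \<Rightarrow> 'x set) \<Rightarrow> 'x \<Rightarrow> nat" where
  "bin_index M B z = (THE i. i \<in> {1..M} \<and> z \<in> B i)"

definition bin_of :: "nat \<Rightarrow> (nat \<Rightarrow> 'x set) \<Rightarrow> 'x \<Rightarrow> 'x set" where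
  "bin_of M B z = B (bin_index M B z)"

definition quantizer :: "nat \<Rightarrow> (nat \<Rightarrow> 'x set) \<Rightarrow> (nat \<Rightarrow> 'x) \<Rightarrow> 'x \<Rightarrow> 'x" where
  "quantizer M B y x = y (bin_index M B x)"

definition bin_weight :: "nat \<Rightarrow> (nat \<Rightarrow> 'x set) \<Rightarrow> 'x measure \<Rightarrow> 'x \<Rightarrow> 'x measure" where
  "bin_weight M B \<pi> z = uniform_measure \<pi> (bin_of M B z)"

definition fin_cost ::
  "nat \<Rightarrow> (nat \<Rightarrow> 'x set) \<Rightarrow> 'x measure \<Rightarrow> ('x \<Rightarrow> 'u \<Rightarrow> real) \<Rightarrow> 'x \<Rightarrow> 'u \<Rightarrow> real" where
  "fin_cost M B \<pi> c z u = (LINT x:bin_of M B z|bin_weight M B \<pi> z. c x u)"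

text \<open>\<open>fin_prob M B \<pi> T z' z u\<close> is the probability of a transition from \<open>z\<close> to \<open>z'\<close>.\<close>

definition fin_prob ::
  "nat \<Rightarrow> (nat \<Rightarrow> 'x set) \<Rightarrow> 'x measure \<Rightarrow> ('x \<Rightarrow> 'u \<Rightarrow> 'x measure) \<Rightarrow> 'x \<Rightarrow> 'x \<Rightarrow> 'u \<Rightarrow> real" where
  "fin_prob M B \<pi> T z' z u =
     (LINT x:bin_of M B z|bin_weight M B \<pi> z. measure (T x u) (bin_of M B z'))"

definition fin_kernel ::
  "nat \<Rightarrow> (nat \<Rightarrow> 'x set) \<Rightarrow> (nat \<Rightarrow> 'x) \<Rightarrow> 'x measure \<Rightarrow> ('x \<Rightarrow> 'u \<Rightarrow> 'x measure)
    \<Rightarrow> 'x \<Rightarrow> 'u \<Rightarrow> 'x measure" where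
  "fin_kernel M B y \<pi> T z u =
     point_measure (y ` {1..M}) (\<lambda>z'. ennreal (fin_prob M B \<pi> T z' z u))"

definition fin_opt_avg_cost ::
  "nat \<Rightarrow> (nat \<Rightarrow> 'x set) \<Rightarrow> (nat \<Rightarrow> 'x) \<Rightarrow> 'x measure \<Rightarrow> 'u measure \<Rightarrow> ('x \<Rightarrow> 'u \<Rightarrow> 'x measure)
    \<Rightarrow> ('x \<Rightarrow> 'u \<Rightarrow> real) \<Rightarrow> 'x \<Rightarrow> ereal" where
  "fin_opt_avg_cost M B y \<pi> A T c x =
     opt_avg_cost (count_space (y ` {1..M})) A (fin_kernel M B y \<pi> T) (fin_cost M B \<pi> c)
       (quantizer M B y x)"

definition loss :: "nat \<Rightarrow> (nat \<Rightarrow> (real ^ 'n) set) \<Rightarrow> (real ^ 'n) measure \<Rightarrow> real ^ 'n \<Rightarrow> ennreal" where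
  "loss M B \<pi> x = (\<integral>\<^sup>+x'\<in>bin_of M B x. ennreal (l1_norm (x - x')) \<partial>bin_weight M B \<pi> x)"

section \<open>Relative value functions\<close>

definition rel_value ::
  "'x measure \<Rightarrow> 'u set \<Rightarrow> ('x \<Rightarrow> 'u \<Rightarrow> 'x measure) \<Rightarrow> ('x \<Rightarrow> 'u \<Rightarrow> real) \<Rightarrow> 'x measure
    \<Rightarrow> ('x \<Rightarrow> real) \<Rightarrow> bool" where
  "rel_value S U T c \<mu> h \<longleftrightarrow>
     h \<in> borel_measurable S \<and> (\<exists>K. \<forall>x\<in>space S. \<bar>h x\<bar> \<le> K) \<and>
     (\<forall>x\<in>space S. h x = (INF u\<in>U. c x u + (\<integral>x\<^sub>1. h x\<^sub>1 \<partial>T x u)) - (\<integral>x. h x \<partial>\<mu>))"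

text \<open>Only the values of \<open>hh\<close> on the representatives matter.\<close>

definition fin_rel_value ::
  "nat \<Rightarrow> (nat \<Rightarrow> 'x set) \<Rightarrow> (nat \<Rightarrow> 'x) \<Rightarrow> 'x measure \<Rightarrow> 'u set \<Rightarrow> ('x \<Rightarrow> 'u \<Rightarrow> 'x measure)
    \<Rightarrow> ('x \<Rightarrow> 'u \<Rightarrow> real) \<Rightarrow> 'x measure \<Rightarrow> ('x \<Rightarrow> real) \<Rightarrow> bool" where
  "fin_rel_value M B y \<pi> U T c \<mu> hh \<longleftrightarrow>
     (\<forall>z\<in>y ` {1..M}. hh z =
        (INF u\<in>U. fin_cost M B \<pi> c z u + (\<Sum>z\<^sub>1\<in>y ` {1..M}. hh z\<^sub>1 * fin_prob M B \<pi> T z\<^sub>1 z u))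
        - (\<integral>x. hh (quantizer M B y x) \<partial>\<mu>))"

end

theory Submission
  imports Defs
begin

text \<open>
  If \<open>h\<close> is a bounded solution of the optimality equation, integrating it along the controlled
  process telescopes, so the optimal average cost is the constant \<open>j = \<integral>h d\<mu>\<close>; solutions exist
  because value iteration for the sub-Markovian kernel \<open>T - \<mu>\<close>, started from \<open>0\<close>, is increasing
  and bounded by \<open>\<parallel>c\<parallel> / \<mu>(X)\<close>. The finite model is minorized by the image of \<open>\<mu>\<close> under the
  quantizer, so the same applies to it.

  For the bound, put \<open>g = h - hh \<circ> q\<close>. Subtracting the two optimality equations and using that
  \<open>T - \<mu>\<close> is a positive kernel gives
  \<open>\<bar>g(x)\<bar> \<le> K L(x) + sup\<^sub>u \<integral>\<bar>g\<bar> dT(\<cdot>|x,u) - \<integral>\<bar>g\<bar> d\<mu>\<close>. The supremum is attained by \<open>\<gamma>\<^sub>s\<close>, so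
  integrating against the invariant measure \<open>\<rho>\<close> cancels \<open>\<integral>\<bar>g\<bar> d\<rho>\<close> and leaves
  \<open>\<bar>\<integral>g d\<mu>\<bar> \<le> \<integral>\<bar>g\<bar> d\<mu> \<le> K \<integral>L d\<rho>\<close>.
\<close>

section \<open>Integrals, finite minima and measurable selection\<close>

lemma (in finite_measure) integrable_of_bounded:
  fixes f :: "'a \<Rightarrow> real"
  assumes "f \<in> borel_measurable M" "\<And>x. x \<in> space M \<Longrightarrow> \<bar>f x\<bar> \<le> K"
  shows "integrable M f"
  using assms by (intro integrable_const_bound[of _ K]) auto

text \<open>Over a finite set the infimum is an iterated \<open>min\<close>, which is continuous, so
  it commutes with pointwise limits. Value iteration uses this to pass to the limit in the
  optimality equation.\<close>

lemma tendsto_INF_finite: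
  fixes F :: "nat \<Rightarrow> 'u \<Rightarrow> real"
  assumes "finite V" "V \<noteq> {}" "\<And>u. u \<in> V \<Longrightarrow> (\<lambda>n. F n u) \<longlonglongrightarrow> G u"
  shows "(\<lambda>n. INF u\<in>V. F n u) \<longlonglongrightarrow> (INF u\<in>V. G u)"
  using assms
proof (induction V rule: finite_ne_induct)
  case (insert v V)
  have "(\<lambda>n. min (F n v) (INF u\<in>V. F n u)) \<longlonglongrightarrow> min (G v) (INF u\<in>V. G u)"
    using insert by (intro tendsto_min) auto
  then show ?case
    using insert.hyps by (simp add: cInf_insert inf_min)
qed auto

text \<open>Monotonicity in the measure is immediate for nonnegative integrals; a bounded
  \<open>f\<close> and finite measures bring the inequality down to the reals. It is the source of
  the positivity of \<open>T - \<mu>\<close>.\<close>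

lemma integral_mono_measure_real:
  fixes f :: "'a \<Rightarrow> real"
  assumes sets: "sets M = sets N" and le: "\<And>D. D \<in> sets N \<Longrightarrow> emeasure M D \<le> emeasure N D"
    and fin: "finite_measure N"
    and f: "f \<in> borel_measurable N" "\<And>x. x \<in> space N \<Longrightarrow> 0 \<le> f x" "\<And>x. x \<in> space N \<Longrightarrow> f x \<le> K"
  shows "(\<integral>x. f x \<partial>M) \<le> (\<integral>x. f x \<partial>N)"
proof -
  have sp: "space M = space N" by (rule sets_eq_imp_space_eq[OF sets])
  have "emeasure M (space M) \<noteq> \<infinity>"
    using le[of "space N"] finite_measure.emeasure_finite[OF fin, of "space N"] by (auto simp: sp top_unique)
  then interpret M: finite_measure M by (rule finite_measureI)
  interpret N: finite_measure N by (rule fin)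
  have fM: "f \<in> borel_measurable M" using f(1) by (simp cong: measurable_cong_sets add: sets)
  have "M \<le> N" using le by (simp add: le_measure[OF sets] le_fun_def emeasure_notin_sets sets)
  then have "(\<integral>\<^sup>+x. ennreal (f x) \<partial>M) \<le> (\<integral>\<^sup>+x. ennreal (f x) \<partial>N)"
    by (intro nn_integral_mono_measure) (auto simp: sets)
  then show ?thesis
    using f fM
    by (subst (asm) (1 2) nn_integral_eq_integral)
       (auto simp: sp integral_nonneg_AE ennreal_le_iff intro!: M.integrable_of_bounded[of _ K] N.integrable_of_bounded[of _ K] Bochner_Integration.integral_nonneg)
qed

text \<open>\<open>ennreal\<close> cuts negative values off at 0, so the right side integrates the
  positive part of \<open>f\<close>. This lets an estimate on a signed integrand continue in the
  extended nonnegative reals.\<close>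

lemma ennreal_integral_le_nn_integral:
  assumes "integrable M f"
  shows "ennreal (\<integral>x. f x \<partial>M) \<le> (\<integral>\<^sup>+x. ennreal (f x) \<partial>M)"
proof -
  have i: "integrable M (\<lambda>x. max 0 (f x))" using assms by simp
  have "ennreal (\<integral>x. f x \<partial>M) \<le> ennreal (\<integral>x. max 0 (f x) \<partial>M)"
    by (intro ennreal_leI integral_mono assms i) simp
  also have "\<dots> = (\<integral>\<^sup>+x. ennreal (max 0 (f x)) \<partial>M)"
    by (rule nn_integral_eq_integral[OF i, symmetric]) simp
  also have "\<dots> = (\<integral>\<^sup>+x. ennreal (f x) \<partial>M)"
    by (rule nn_integral_cong) (simp add: max_def ennreal_neg)
  finally show ?thesis .
qed

text \<open>Induction over the actions: the new action is taken where its value is at most the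
  minimum over the earlier ones, and comparing two measurable functions cuts out a measurable
  set.\<close>

lemma measurable_minimizer:
  fixes F :: "'x \<Rightarrow> 'u \<Rightarrow> real"
  assumes "finite V" "V \<noteq> {}" "V \<subseteq> space A"
    and F: "\<And>u. u \<in> V \<Longrightarrow> (\<lambda>x. F x u) \<in> borel_measurable S"
  shows "\<exists>f \<in> S \<rightarrow>\<^sub>M A. \<forall>x\<in>space S. f x \<in> V \<and> (\<forall>u\<in>V. F x (f x) \<le> F x u)"
  using assms
proof (induction V rule: finite_ne_induct)
  case (singleton u)
  then show ?case by (intro bexI[of _ "\<lambda>_. u"]) auto
next
  case (insert v V)
  then have "\<exists>f \<in> S \<rightarrow>\<^sub>M A. \<forall>x\<in>space S. f x \<in> V \<and> (\<forall>u\<in>V. F x (f x) \<le> F x u)"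
    by simp
  then obtain f where f[measurable]: "f \<in> S \<rightarrow>\<^sub>M A"
    and min: "\<And>x. x \<in> space S \<Longrightarrow> f x \<in> V \<and> (\<forall>u\<in>V. F x (f x) \<le> F x u)"
    by blast
  have [measurable]: "(\<lambda>x. F x v) \<in> borel_measurable S" using insert.prems by simp
  have MF[measurable]: "(\<lambda>x. INF u\<in>V. F x u) \<in> borel_measurable S"
    using insert.prems insert.hyps by (intro borel_measurable_cINF countable_finite) (auto intro!: bounded_imp_bdd_below finite_imp_bounded)
  have INF_eq: "(INF u\<in>V. F x u) = F x (f x)" if "x \<in> space S" for x
    using min[OF that] insert.hyps by (intro cInf_eq_minimum) auto
  have [measurable]: "v \<in> space A" using insert.prems by simp
  let ?g = "\<lambda>x. if F x v \<le> (INF u\<in>V. F x u) then v else f x"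
  have "?g \<in> S \<rightarrow>\<^sub>M A" by measurable
  moreover have "?g x \<in> insert v V \<and> (\<forall>u\<in>insert v V. F x (?g x) \<le> F x u)" if "x \<in> space S" for x
    using min[OF that] by (auto simp: INF_eq[OF that] intro: order_trans)
  ultimately show ?case by (intro bexI[of _ ?g] ballI)
qed

text \<open>The test functions of \<open>tv_norm\<close> are bounded by 1, so \<open>f / R\<close>
  is one of them and scaling back costs exactly the factor \<open>R\<close>. For
  \<open>R = 0\<close> both integrals vanish.\<close>

lemma tv_norm_integral_le:
  assumes f: "f \<in> borel_measurable M" "\<And>x. x \<in> space M \<Longrightarrow> \<bar>f x\<bar> \<le> R" and R: "0 \<le> R"
    and sp: "space N = space M"
    and tv: "tv_norm M N \<le> ennreal t" and t: "0 \<le> t"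
  shows "\<bar>(\<integral>x. f x \<partial>M) - (\<integral>x. f x \<partial>N)\<bar> \<le> R * t"
proof (cases "R = 0")
  case True
  then have "(\<integral>x. f x \<partial>M) = 0" "(\<integral>x. f x \<partial>N) = 0"
    using f(2) sp by (auto intro!: integral_eq_zero_AE)
  then show ?thesis by (simp add: True)
next
  case False
  with R have R: "0 < R" by simp
  have "ennreal \<bar>(\<integral>x. f x / R \<partial>M) - (\<integral>x. f x / R \<partial>N)\<bar> \<le> tv_norm M N"
    unfolding tv_norm_def using f R by (intro SUP_upper) (auto simp: abs_div_pos[symmetric])
  also note tv
  finally have "\<bar>(\<integral>x. f x / R \<partial>M) - (\<integral>x. f x / R \<partial>N)\<bar> \<le> t" using t by simp
  then show ?thesis
    using R by (simp add: diff_divide_distrib[symmetric] field_simps)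
qed

section \<open>Marginals of the Ionescu-Tulcea process\<close>

context Ionescu_Tulcea
begin

text \<open>\<open>up_to J\<close> is the least index from which on \<open>J\<close> is empty, hence
  \<open>n\<close> for an initial segment. The limit measure is thereby tied to the finite-stage
  laws \<open>C 0 n\<close>, started from the empty history.\<close>

lemma CI_atLeastLessThan: "CI {0..<n} = C 0 n (\<lambda>_. undefined)"
proof -
  have n: "up_to {0..<n} \<le> n" by (simp add: up_to_iff)
  have "{0..<n} \<subseteq> {0..<up_to {0..<n}}" by (rule up_to) simp
  then have "n \<le> up_to {0..<n}" by (cases "n = 0") auto
  with n have eq: "up_to {0..<n} = n" by simp
  have "CI {0..<n} = distr (C 0 n (\<lambda>_. undefined)) (PiM {0..<n} M) (\<lambda>x. restrict x {0..<n})"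
    by (simp add: CI_def eq)
  also have "\<dots> = C 0 n (\<lambda>_. undefined)"
    using distr_C[of n n "\<lambda>_. undefined" 0] by simp
  finally show ?thesis .
qed

lemma restrict_measurable_lim: "(\<lambda>\<omega>. restrict \<omega> J) \<in> PF.lim \<rightarrow>\<^sub>M PiM J M"
  unfolding measurable_cong_sets[OF PF.sets_lim refl] by (rule measurable_restrict_subset) simp

lemma integral_lim_restrict:
  fixes g :: "(nat \<Rightarrow> 'a) \<Rightarrow> real"
  assumes [measurable]: "g \<in> borel_measurable (PiM {0..<n} M)"
  shows "(\<integral>\<omega>. g (restrict \<omega> {0..<n}) \<partial>PF.lim) = (\<integral>\<omega>. g \<omega> \<partial>C 0 n (\<lambda>_. undefined))"
  unfolding CI_atLeastLessThan[symmetric]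
  by (subst distr_lim[symmetric])
     (auto intro!: integral_distr[symmetric] restrict_measurable_lim)

text \<open>The tower property for one coordinate: the law of the first \<open>Suc t\<close>
  coordinates is \<open>C 0 t\<close> followed by one step of \<open>eP t\<close>, which appends a
  coordinate drawn from \<open>P t\<close> given the past.\<close>

lemma integral_lim_component:
  fixes g :: "'a \<Rightarrow> real"
  assumes g[measurable]: "g \<in> borel_measurable (M t)"
    and bnd: "\<And>x. x \<in> space (M t) \<Longrightarrow> \<bar>g x\<bar> \<le> K"
  shows "(\<integral>\<omega>. g (\<omega> t) \<partial>PF.lim) = (\<integral>\<omega>. (\<integral>x. g x \<partial>P t (restrict \<omega> {0..<t})) \<partial>PF.lim)"
proof -
  \<comment> \<open>The product over no coordinates has this as its only point; it serves as the
    history at time 0.\<close>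
  have u: "(\<lambda>_. undefined) \<in> space (PiM {0..<0::nat} M)" by (simp add: space_PiM)
  interpret C: prob_space "C 0 t (\<lambda>_. undefined)" by (rule prob_space_C[OF u])
  have sC: "sets (C 0 t (\<lambda>_. undefined)) = sets (PiM {0..<t} M)" using sets_C[OF u] by simp
  have spC: "space (C 0 t (\<lambda>_. undefined)) = space (PiM {0..<t} M)" using space_C[OF u] by simp
  have [measurable]: "(\<lambda>\<omega>. g (\<omega> t)) \<in> borel_measurable (PiM {0..<Suc t} M)" by measurable
  have [measurable]: "(\<lambda>\<omega>. \<integral>x. g x \<partial>P t \<omega>) \<in> borel_measurable (PiM {0..<t} M)"
    by (rule measurable_compose[OF P integral_measurable_subprob_algebra[OF g]])
  have "(\<integral>\<omega>. g (\<omega> t) \<partial>PF.lim) = (\<integral>\<omega>. g (restrict \<omega> {0..<Suc t} t) \<partial>PF.lim)" by simp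
  also have "\<dots> = (\<integral>\<omega>. g (\<omega> t) \<partial>C 0 (Suc t) (\<lambda>_. undefined))"
    by (rule integral_lim_restrict) measurable
  also have "\<dots> = (\<integral>\<omega>. (\<integral>\<omega>'. g (\<omega>' t) \<partial>eP t \<omega>) \<partial>C 0 t (\<lambda>_. undefined))"
    unfolding C.simps add_0
  proof (rule integral_bind[where K="PiM {0..<Suc t} M" and B=K and B'=1])
    show "eP t \<in> C 0 t (\<lambda>_. undefined) \<rightarrow>\<^sub>M subprob_algebra (PiM {0..<Suc t} M)"
      using measurable_eP[of t] by (simp cong: measurable_cong_sets add: sC)
    show "\<bar>g (x t)\<bar> \<le> K" if "x \<in> space (PiM {0..<Suc t} M)" for x
      using that by (intro bnd) (auto simp: space_PiM PiE_iff)
  qed (auto simp: C.finite_measure_axioms spC prob_space.emeasure_space_1[OF prob_space_eP])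
  also have "\<dots> = (\<integral>\<omega>. (\<integral>x. g x \<partial>P t \<omega>) \<partial>C 0 t (\<lambda>_. undefined))"
  proof (rule Bochner_Integration.integral_cong[OF refl])
    fix \<omega> assume "\<omega> \<in> space (C 0 t (\<lambda>_. undefined))"
    then have w: "\<omega> \<in> space (PiM {0..<t} M)" by (simp add: spC)
    \<comment> \<open>\<open>eP t\<close> is the image of \<open>P t\<close> under writing the
      sample at position \<open>t\<close>, so reading position \<open>t\<close> returns the
      sample.\<close>
    have "fun_upd \<omega> t \<in> P t \<omega> \<rightarrow>\<^sub>M PiM {0..<Suc t} M"
      using w by (intro measurable_fun_upd[where J="{0..<t}"]) (auto simp: sets_P)
    then show "(\<integral>\<omega>'. g (\<omega>' t) \<partial>eP t \<omega>) = (\<integral>x. g x \<partial>P t \<omega>)"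
      unfolding eP_def by (subst integral_distr) auto
  qed
  also have "\<dots> = (\<integral>\<omega>. (\<integral>x. g x \<partial>P t (restrict \<omega> {0..<t})) \<partial>PF.lim)"
    by (rule integral_lim_restrict[symmetric]) measurable
  finally show ?thesis .
qed

text \<open>The limit has the total mass of any of its marginals, and the marginal on no coordinates
  is a probability measure.\<close>

lemma prob_space_lim: "prob_space PF.lim"
proof -
  have "prob_space (distr PF.lim (PiM {} M) (\<lambda>x. restrict x {}))"
    using PF.prob_space_P[of "{}"] by (simp add: distr_lim)
  then show ?thesis by (rule prob_space_distrD[OF restrict_measurable_lim])
qed

end

section \<open>Verification for finitely many actions\<close>

text \<open>The setting is purely measure-theoretic so that the original model and its quantization
  on a finite discrete space are both instances.\<close>

locale finite_action_mdp =
  fixes S :: "'x measure" and A :: "'u measure"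
    and T :: "'x \<Rightarrow> 'u \<Rightarrow> 'x measure" and c :: "'x \<Rightarrow> 'u \<Rightarrow> real"
  assumes kernel[measurable]: "(\<lambda>(x, u). T x u) \<in> S \<Otimes>\<^sub>M A \<rightarrow>\<^sub>M prob_algebra S"
    and cost_measurable[measurable]: "(\<lambda>(x, u). c x u) \<in> borel_measurable (S \<Otimes>\<^sub>M A)"
    and cost_bounded: "\<exists>K. \<forall>x\<in>space S. \<forall>u\<in>space A. \<bar>c x u\<bar> \<le> K"
    and finite_actions: "finite (space A)"
    and actions_nonempty: "space A \<noteq> {}"
begin

lemma kernel_subprob[measurable]: "(\<lambda>(x, u). T x u) \<in> S \<Otimes>\<^sub>M A \<rightarrow>\<^sub>M subprob_algebra S"
  by (rule measurable_prob_algebraD[OF kernel])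

lemma
  assumes "x \<in> space S" "u \<in> space A"
  shows sets_kernel: "sets (T x u) = sets S" and space_kernel: "space (T x u) = space S"
    and prob_space_kernel: "prob_space (T x u)"
proof -
  have "T x u \<in> space (prob_algebra S)"
    using measurable_space[OF kernel, of "(x, u)"] assms by (simp add: space_pair_measure)
  then show "sets (T x u) = sets S" "prob_space (T x u)" by (auto simp: space_prob_algebra)
  from sets_eq_imp_space_eq[OF this(1)] show "space (T x u) = space S" .
qed

lemma integrable_kernel:
  assumes "x \<in> space S" "u \<in> space A" "f \<in> borel_measurable S" "\<And>x. x \<in> space S \<Longrightarrow> \<bar>f x\<bar> \<le> (K::real)"
  shows "integrable (T x u) f"
proof -
  interpret prob_space "T x u" using assms by (intro prob_space_kernel)
  have "f \<in> borel_measurable (T x u)"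
    using assms(3) by (simp cong: measurable_cong_sets add: sets_kernel[OF assms(1,2)])
  then show ?thesis using assms(4) by (intro integrable_of_bounded[of _ K]) (auto simp: space_kernel[OF assms(1,2)])
qed

lemma integral_kernel_bounded:
  assumes "x \<in> space S" "u \<in> space A" "f \<in> borel_measurable S" "\<And>x. x \<in> space S \<Longrightarrow> \<bar>f x\<bar> \<le> (K::real)"
  shows "\<bar>\<integral>z. f z \<partial>T x u\<bar> \<le> K"
proof -
  interpret prob_space "T x u" using assms by (intro prob_space_kernel)
  have "\<bar>\<integral>z. f z \<partial>T x u\<bar> \<le> (\<integral>z. \<bar>f z\<bar> \<partial>T x u)" by (rule integral_abs_bound)
  also have "\<dots> \<le> (\<integral>z. K \<partial>T x u)"
    using assms by (intro integral_mono integrable_abs integrable_kernel[of _ _ _ K] integrable_const)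
      (simp_all add: space_kernel)
  also have "\<dots> = K" by (simp add: prob_space)
  finally show ?thesis .
qed

lemma borel_measurable_kernel_integral:
  fixes f :: "'x \<Rightarrow> real"
  assumes [measurable]: "f \<in> borel_measurable S"
  shows "(\<lambda>(x, u). \<integral>z. f z \<partial>T x u) \<in> borel_measurable (S \<Otimes>\<^sub>M A)"
  using measurable_compose[OF kernel_subprob integral_measurable_subprob_algebra[OF assms]]
  by (simp add: case_prod_beta')

text \<open>The expression under the infimum of the optimality equation, kept per action so that
  fixed controls, minimizers and bin averages can be compared with it.\<close>

definition bellman :: "('x \<Rightarrow> real) \<Rightarrow> 'x \<Rightarrow> 'u \<Rightarrow> real" where
  "bellman h x u = c x u + (\<integral>z. h z \<partial>T x u)"

lemma borel_measurable_bellman[measurable]: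
  assumes "h \<in> borel_measurable S"
  shows "(\<lambda>(x, u). bellman h x u) \<in> borel_measurable (S \<Otimes>\<^sub>M A)"
  using borel_measurable_kernel_integral[OF assms] unfolding bellman_def by measurable

lemma bellman_selector:
  assumes h[measurable]: "h \<in> borel_measurable S"
  obtains f where "f \<in> S \<rightarrow>\<^sub>M A" "\<And>x. x \<in> space S \<Longrightarrow> bellman h x (f x) = (INF u\<in>space A. bellman h x u)"
proof -
  have "(\<lambda>x. bellman h x u) \<in> borel_measurable S" if [measurable]: "u \<in> space A" for u
    using measurable_compose[OF _ borel_measurable_bellman[OF h], of "\<lambda>x. (x, u)" S] by simp
  then obtain f where f: "f \<in> S \<rightarrow>\<^sub>M A"
    and min: "\<And>x. x \<in> space S \<Longrightarrow> f x \<in> space A \<and> (\<forall>u\<in>space A. bellman h x (f x) \<le> bellman h x u)"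
    using measurable_minimizer[OF finite_actions actions_nonempty subset_refl, of "bellman h" S] by blast
  have "(INF u\<in>space A. bellman h x u) = bellman h x (f x)" if "x \<in> space S" for x
    using min[OF that] by (intro cInf_eq_minimum) auto
  with f that show thesis by metis
qed

lemma INF_bellman_le: "u \<in> space A \<Longrightarrow> (INF u\<in>space A. bellman h x u) \<le> bellman h x u"
  by (intro cINF_lower) (auto intro!: bounded_imp_bdd_below finite_imp_bounded finite_actions)

end

locale controlled_mdp = finite_action_mdp S A T c
  for S :: "'x measure" and A :: "'u measure" and T c +
  fixes \<gamma> :: "('x, 'u) policy" and x\<^sub>0 :: 'x
  assumes adm: "admissible S A \<gamma>" and x\<^sub>0: "x\<^sub>0 \<in> space S"
begin

abbreviation law :: "(nat \<Rightarrow> 'x \<times> 'u) measure" where "law \<equiv> process_law S A T \<gamma> x\<^sub>0"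

lemma adm_measurable[measurable]:
  "(\<lambda>(h, x). \<gamma> t h x) \<in> (\<Pi>\<^sub>M s\<in>{0..<t}. S \<Otimes>\<^sub>M A) \<Otimes>\<^sub>M S \<rightarrow>\<^sub>M A"
  using adm by (auto simp: admissible_def)

lemma state_kernel_measurable:
  fixes t :: nat
  shows
  "(\<lambda>h. if t = 0 then return S x\<^sub>0 else T (fst (h (t - 1))) (snd (h (t - 1))))
     \<in> (\<Pi>\<^sub>M s\<in>{0..<t}. S \<Otimes>\<^sub>M A) \<rightarrow>\<^sub>M prob_algebra S"
proof (cases t)
  case 0
  have "return S x\<^sub>0 \<in> space (prob_algebra S)"
    using x\<^sub>0 by (simp add: space_prob_algebra prob_space_return)
  then show ?thesis unfolding 0 by simp
next
  case (Suc s)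
  have "(\<lambda>h. h s) \<in> (\<Pi>\<^sub>M s\<in>{0..<t}. S \<Otimes>\<^sub>M A) \<rightarrow>\<^sub>M S \<Otimes>\<^sub>M A"
    using Suc by (intro measurable_component_singleton) auto
  from measurable_compose[OF this kernel] show ?thesis
    by (simp add: Suc case_prod_beta')
qed

lemma pair_kernel_measurable:
  "pair_kernel S A T \<gamma> x\<^sub>0 t \<in> (\<Pi>\<^sub>M s\<in>{0..<t}. S \<Otimes>\<^sub>M A) \<rightarrow>\<^sub>M prob_algebra (S \<Otimes>\<^sub>M A)"
  unfolding pair_kernel_def[abs_def]
  by (rule measurable_distr_prob_space2[OF state_kernel_measurable]) measurable

lemma Ionescu_Tulcea_pair_kernel: "Ionescu_Tulcea (pair_kernel S A T \<gamma> x\<^sub>0) (\<lambda>_. S \<Otimes>\<^sub>M A)"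
proof (rule Ionescu_Tulcea.intro)
  show "pair_kernel S A T \<gamma> x\<^sub>0 i \<in> (\<Pi>\<^sub>M s\<in>{0..<i}. S \<Otimes>\<^sub>M A) \<rightarrow>\<^sub>M subprob_algebra (S \<Otimes>\<^sub>M A)" for i
    by (rule measurable_prob_algebraD[OF pair_kernel_measurable])
  show "prob_space (pair_kernel S A T \<gamma> x\<^sub>0 i h)" if "h \<in> space (\<Pi>\<^sub>M s\<in>{0..<i}. S \<Otimes>\<^sub>M A)" for i h
    using measurable_space[OF pair_kernel_measurable that] by (simp add: space_prob_algebra)
qed

lemma prob_space_law: "prob_space law"
proof -
  interpret IT: Ionescu_Tulcea "pair_kernel S A T \<gamma> x\<^sub>0" "\<lambda>_. S \<Otimes>\<^sub>M A"
    by (rule Ionescu_Tulcea_pair_kernel)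
  show ?thesis unfolding process_law_def by (rule IT.prob_space_lim)
qed

lemma sets_law[measurable_cong]: "sets law = sets (\<Pi>\<^sub>M s\<in>UNIV. S \<Otimes>\<^sub>M A)"
proof -
  interpret IT: Ionescu_Tulcea "pair_kernel S A T \<gamma> x\<^sub>0" "\<lambda>_. S \<Otimes>\<^sub>M A"
    by (rule Ionescu_Tulcea_pair_kernel)
  show ?thesis unfolding process_law_def by (rule IT.PF.sets_lim)
qed

lemma space_law: "space law = space (\<Pi>\<^sub>M s\<in>UNIV. S \<Otimes>\<^sub>M A)"
  by (rule sets_eq_imp_space_eq[OF sets_law])

lemma component_space:
  assumes "\<omega> \<in> space law"
  shows "\<omega> t \<in> space (S \<Otimes>\<^sub>M A)" "fst (\<omega> t) \<in> space S" "snd (\<omega> t) \<in> space A"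
proof -
  show "\<omega> t \<in> space (S \<Otimes>\<^sub>M A)" using assms by (auto simp: space_law space_PiM)
  then show "fst (\<omega> t) \<in> space S" "snd (\<omega> t) \<in> space A" by (auto simp: space_pair_measure)
qed

text \<open>The pair at time \<open>t\<close> consists of a state drawn from the transition law (or
  the initial state at time 0) and the action computed from it; integrating the pair out leaves an
  integral over the new state.\<close>

lemma integral_law_component:
  fixes g :: "'x \<Rightarrow> 'u \<Rightarrow> real"
  assumes g[measurable]: "(\<lambda>(x, u). g x u) \<in> borel_measurable (S \<Otimes>\<^sub>M A)"
    and bnd: "\<And>x u. x \<in> space S \<Longrightarrow> u \<in> space A \<Longrightarrow> \<bar>g x u\<bar> \<le> K"
  shows "(\<integral>\<omega>. g (fst (\<omega> t)) (snd (\<omega> t)) \<partial>law) =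
    (\<integral>\<omega>. (\<integral>x. g x (\<gamma> t (restrict \<omega> {0..<t}) x)
        \<partial>(if t = 0 then return S x\<^sub>0 else T (fst (\<omega> (t - 1))) (snd (\<omega> (t - 1))))) \<partial>law)"
proof -
  interpret IT: Ionescu_Tulcea "pair_kernel S A T \<gamma> x\<^sub>0" "\<lambda>_. S \<Otimes>\<^sub>M A"
    by (rule Ionescu_Tulcea_pair_kernel)
  have law: "law = IT.PF.lim" by (simp add: process_law_def)
  have "(\<integral>\<omega>. (case \<omega> t of (x, u) \<Rightarrow> g x u) \<partial>law) =
      (\<integral>\<omega>. (\<integral>z. (case z of (x, u) \<Rightarrow> g x u) \<partial>pair_kernel S A T \<gamma> x\<^sub>0 t (restrict \<omega> {0..<t})) \<partial>law)"
    unfolding law by (rule IT.integral_lim_component[OF g, of K]) (auto simp: space_pair_measure bnd)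
  also have "\<dots> = (\<integral>\<omega>. (\<integral>x. g x (\<gamma> t (restrict \<omega> {0..<t}) x)
        \<partial>(if t = 0 then return S x\<^sub>0 else T (fst (\<omega> (t - 1))) (snd (\<omega> (t - 1))))) \<partial>law)"
  proof (rule Bochner_Integration.integral_cong[OF refl])
    fix \<omega> assume w: "\<omega> \<in> space law"
    let ?h = "restrict \<omega> {0..<t}"
    let ?N = "if t = 0 then return S x\<^sub>0 else T (fst (\<omega> (t - 1))) (snd (\<omega> (t - 1)))"
    \<comment> \<open>Position \<open>t - 1\<close> lies in \<open>{0..<t}\<close> when
      \<open>t > 0\<close>, and at \<open>t = 0\<close> no past pair is read, so restricting the
      history leaves the transition law unchanged.\<close>
    have N: "(if t = 0 then return S x\<^sub>0 else T (fst (?h (t - 1))) (snd (?h (t - 1)))) = ?N"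
      by (cases t) auto
    have sN: "sets ?N = sets S" using component_space[OF w] by (simp add: sets_kernel)
    have h: "?h \<in> space (\<Pi>\<^sub>M s\<in>{0..<t}. S \<Otimes>\<^sub>M A)"
      using component_space(1)[OF w] by (simp add: space_PiM)
    have "(\<lambda>x. (?h, x)) \<in> S \<rightarrow>\<^sub>M (\<Pi>\<^sub>M s\<in>{0..<t}. S \<Otimes>\<^sub>M A) \<Otimes>\<^sub>M S"
      using h by measurable
    from measurable_compose[OF this adm_measurable]
    have "\<gamma> t ?h \<in> S \<rightarrow>\<^sub>M A" by simp
    then have "(\<lambda>x. (x, \<gamma> t ?h x)) \<in> ?N \<rightarrow>\<^sub>M S \<Otimes>\<^sub>M A"
      unfolding measurable_cong_sets[OF sN refl] by measurable
    then show "(\<integral>z. (case z of (x, u) \<Rightarrow> g x u) \<partial>pair_kernel S A T \<gamma> x\<^sub>0 t ?h) = (\<integral>x. g x (\<gamma> t ?h x) \<partial>?N)"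
      unfolding pair_kernel_def N by (subst integral_distr[OF _ g]) auto
  qed
  finally show ?thesis by (simp add: case_prod_beta')
qed

end

section \<open>Expected costs and telescoping along the controlled process\<close>

context controlled_mdp
begin

lemma expectation_next_state:
  fixes f :: "'x \<Rightarrow> real"
  assumes [measurable]: "f \<in> borel_measurable S" and bnd: "\<And>x. x \<in> space S \<Longrightarrow> \<bar>f x\<bar> \<le> K"
  shows "(\<integral>\<omega>. f (fst (\<omega> (Suc t))) \<partial>law) = (\<integral>\<omega>. (\<integral>z. f z \<partial>T (fst (\<omega> t)) (snd (\<omega> t))) \<partial>law)"
  using integral_law_component[of "\<lambda>x _. f x" K "Suc t"] bnd by simp

lemma integrable_law_component:
  fixes g :: "'x \<Rightarrow> 'u \<Rightarrow> real"
  assumes g[measurable]: "(\<lambda>(x, u). g x u) \<in> borel_measurable (S \<Otimes>\<^sub>M A)"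
    and bnd: "\<And>x u. x \<in> space S \<Longrightarrow> u \<in> space A \<Longrightarrow> \<bar>g x u\<bar> \<le> K"
  shows "integrable law (\<lambda>\<omega>. g (fst (\<omega> t)) (snd (\<omega> t)))"
proof -
  interpret prob_space law by (rule prob_space_law)
  have "(\<lambda>\<omega>. \<omega> t) \<in> law \<rightarrow>\<^sub>M S \<Otimes>\<^sub>M A"
    unfolding measurable_cong_sets[OF sets_law refl] by (rule measurable_component_singleton) simp
  from measurable_compose[OF this g]
  show ?thesis
    by (intro integrable_of_bounded[of _ K]) (auto simp: case_prod_beta' bnd component_space)
qed

lemma law_component_bounds:
  fixes g :: "'x \<Rightarrow> 'u \<Rightarrow> real"
  assumes g: "(\<lambda>(x, u). g x u) \<in> borel_measurable (S \<Otimes>\<^sub>M A)"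
    and bnd: "\<And>x u. x \<in> space S \<Longrightarrow> u \<in> space A \<Longrightarrow> \<bar>g x u\<bar> \<le> K"
  shows "\<bar>\<integral>\<omega>. g (fst (\<omega> t)) (snd (\<omega> t)) \<partial>law\<bar> \<le> K"
proof -
  interpret prob_space law by (rule prob_space_law)
  have "\<bar>\<integral>\<omega>. g (fst (\<omega> t)) (snd (\<omega> t)) \<partial>law\<bar> \<le> (\<integral>\<omega>. \<bar>g (fst (\<omega> t)) (snd (\<omega> t))\<bar> \<partial>law)"
    by (rule integral_abs_bound)
  also have "\<dots> \<le> (\<integral>\<omega>. K \<partial>law)"
    using assms
    by (intro integral_mono integrable_abs integrable_law_component[of _ K] integrable_const)
       (simp_all add: component_space)
  also have "\<dots> = K" by (simp add: prob_space)
  finally show ?thesis .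
qed

context
  fixes h :: "'x \<Rightarrow> real" and K :: real
  assumes h[measurable]: "h \<in> borel_measurable S" and h_bnd: "\<And>x. x \<in> space S \<Longrightarrow> \<bar>h x\<bar> \<le> K"
begin

abbreviation "value_mean t \<equiv> \<integral>\<omega>. h (fst (\<omega> t)) \<partial>law"
abbreviation "cost_mean t \<equiv> \<integral>\<omega>. c (fst (\<omega> t)) (snd (\<omega> t)) \<partial>law"
abbreviation "bellman_mean t \<equiv> \<integral>\<omega>. bellman h (fst (\<omega> t)) (snd (\<omega> t)) \<partial>law"

lemma value_mean_bounded: "\<bar>value_mean t\<bar> \<le> K"
  using law_component_bounds[of "\<lambda>x _. h x" K t] h_bnd by simp

lemma bellman_bounded: "\<exists>K. \<forall>x\<in>space S. \<forall>u\<in>space A. \<bar>bellman h x u\<bar> \<le> K"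
proof -
  obtain C where C: "\<And>x u. x \<in> space S \<Longrightarrow> u \<in> space A \<Longrightarrow> \<bar>c x u\<bar> \<le> C"
    using cost_bounded by auto
  have "\<bar>bellman h x u\<bar> \<le> C + K" if "x \<in> space S" "u \<in> space A" for x u
    unfolding bellman_def using C[OF that] integral_kernel_bounded[OF that h h_bnd] by linarith
  then show ?thesis by blast
qed

text \<open>By the Markov property the expected continuation term is the value one step later. This
  turns relations for \<open>bellman h\<close> into a telescoping sum.\<close>

lemma bellman_mean: "bellman_mean t = cost_mean t + value_mean (Suc t)"
proof -
  obtain C where C: "\<And>x u. x \<in> space S \<Longrightarrow> u \<in> space A \<Longrightarrow> \<bar>c x u\<bar> \<le> C"
    using cost_bounded by auto
  have "bellman_mean t = cost_mean t + (\<integral>\<omega>. (\<integral>z. h z \<partial>T (fst (\<omega> t)) (snd (\<omega> t))) \<partial>law)"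
    unfolding bellman_def
    using integrable_law_component[OF cost_measurable C, of t]
      integrable_law_component[OF borel_measurable_kernel_integral[OF h] integral_kernel_bounded[OF _ _ h h_bnd], of t]
    by (rule Bochner_Integration.integral_add)
  then show ?thesis by (simp add: expectation_next_state[OF h h_bnd])
qed

lemma total_cost_mean: "(\<integral>\<omega>. (\<Sum>t<n. c (fst (\<omega> t)) (snd (\<omega> t))) \<partial>law) = (\<Sum>t<n. cost_mean t)"
  using cost_bounded integrable_law_component[OF cost_measurable]
  by (intro Bochner_Integration.integral_sum) blast

lemma integrable_value: "integrable law (\<lambda>\<omega>. h (fst (\<omega> t)))"
  using integrable_law_component[of "\<lambda>x _. h x" K t] h_bnd by simp

lemma integrable_bellman: "integrable law (\<lambda>\<omega>. bellman h (fst (\<omega> t)) (snd (\<omega> t)))"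
  using bellman_bounded integrable_law_component[OF borel_measurable_bellman[OF h]] by blast

text \<open>Summing the averaged inequality telescopes the values of \<open>h\<close>. Only the
  first and the last remain, both bounded by \<open>K\<close>, so under any policy the mean cost
  over \<open>n\<close> steps is at least \<open>j - 2 * K / n\<close>.\<close>

lemma avg_cost_ge:
  assumes le: "\<And>x u. x \<in> space S \<Longrightarrow> u \<in> space A \<Longrightarrow> h x + j \<le> bellman h x u"
  shows "ereal j \<le> avg_cost S A T c x\<^sub>0 \<gamma>"
proof -
  interpret prob_space law by (rule prob_space_law)
  have step: "value_mean t + j \<le> cost_mean t + value_mean (Suc t)" for t
  proof -
    have "value_mean t + j = (\<integral>\<omega>. h (fst (\<omega> t)) + j \<partial>law)"
      using integrable_value by (simp add: prob_space)
    also have "\<dots> \<le> bellman_mean t"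
      using integrable_value integrable_bellman le component_space
      by (intro integral_mono) auto
    finally show ?thesis by (simp add: bellman_mean)
  qed
  have tot: "value_mean 0 + real n * j \<le> (\<Sum>t<n. cost_mean t) + value_mean n" for n
  proof (induction n)
    case (Suc n)
    then show ?case using step[of n] by (simp add: algebra_simps)
  qed simp
  \<comment> \<open>At \<open>n = 0\<close> division by zero yields 0 and the inequality would read
    \<open>j \<le> 0\<close>; the limit superior sees only large \<open>n\<close>.\<close>
  have "ereal (j - 2 * K / real n) \<le> ereal (1 / real n * (\<Sum>t<n. cost_mean t))" if "0 < n" for n
  proof -
    have "real n * j - 2 * K \<le> (\<Sum>t<n. cost_mean t)"
      using tot[of n] value_mean_bounded[of 0] value_mean_bounded[of n] by linarith
    then have "(real n * j - 2 * K) / real n \<le> (\<Sum>t<n. cost_mean t) / real n"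
      by (intro divide_right_mono) auto
    then show ?thesis using that by (simp add: diff_divide_distrib)
  qed
  then have "limsup (\<lambda>n. ereal (j - 2 * K / real n)) \<le> avg_cost S A T c x\<^sub>0 \<gamma>"
    unfolding avg_cost_def total_cost_mean
    by (intro Limsup_mono eventually_sequentiallyI[of 1]) auto
  moreover have "(\<lambda>n. ereal (j - 2 * K / real n)) \<longlonglongrightarrow> ereal (j - 0)"
    by (intro tendsto_intros tendsto_ereal lim_const_over_n)
  ultimately show ?thesis by (simp add: lim_imp_Limsup)
qed

text \<open>The same telescoping, now with equality at each step, because the control
  \<open>\<phi>\<close> solves the equation at every state.\<close>

lemma avg_cost_le:
  assumes eq: "\<And>x. x \<in> space S \<Longrightarrow> bellman h x (\<phi> x) = h x + j"
    and \<phi>[measurable]: "\<phi> \<in> S \<rightarrow>\<^sub>M A" and \<gamma>: "\<gamma> = (\<lambda>t h x. \<phi> x)"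
  shows "avg_cost S A T c x\<^sub>0 \<gamma> \<le> ereal j"
proof -
  interpret prob_space law by (rule prob_space_law)
  obtain L where L: "\<And>x u. x \<in> space S \<Longrightarrow> u \<in> space A \<Longrightarrow> \<bar>bellman h x u\<bar> \<le> L"
    using bellman_bounded by auto
  have step: "cost_mean t + value_mean (Suc t) = value_mean t + j" for t
  proof -
    have [measurable]: "(\<lambda>x. (x, \<phi> x)) \<in> S \<rightarrow>\<^sub>M S \<Otimes>\<^sub>M A" by measurable
    have m: "(\<lambda>(x, u). bellman h x (\<phi> x)) \<in> borel_measurable (S \<Otimes>\<^sub>M A)"
      using measurable_compose[OF measurable_compose[OF measurable_fst, of "\<lambda>x. (x, \<phi> x)" S "S \<Otimes>\<^sub>M A" A]
          borel_measurable_bellman[OF h]]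
      by (simp add: case_prod_beta')
    have b: "\<bar>bellman h x (\<phi> x)\<bar> \<le> L" if "x \<in> space S" "u \<in> space A" for x u
      using L that measurable_space[OF \<phi>] by auto
    \<comment> \<open>Both expectations reduce to the same integral over the new state, since the
      action at time \<open>t\<close> is \<open>\<phi>\<close> of that state; the integrand in
      \<open>m\<close> is constant in \<open>u\<close>.\<close>
    have "bellman_mean t = (\<integral>\<omega>. bellman h (fst (\<omega> t)) (\<phi> (fst (\<omega> t))) \<partial>law)"
      using integral_law_component[where t=t, OF borel_measurable_bellman[OF h] L]
        integral_law_component[where t=t, OF m b] by (simp add: \<gamma>)
    also have "\<dots> = (\<integral>\<omega>. h (fst (\<omega> t)) + j \<partial>law)"
      by (intro Bochner_Integration.integral_cong) (auto simp: eq component_space)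
    also have "\<dots> = value_mean t + j"
      using integrable_value by (simp add: prob_space)
    finally show ?thesis by (simp add: bellman_mean)
  qed
  have tot: "(\<Sum>t<n. cost_mean t) + value_mean n = value_mean 0 + real n * j" for n
  proof (induction n)
    case (Suc n)
    then show ?case using step[of n] by (simp add: algebra_simps)
  qed simp
  have "ereal (1 / real n * (\<Sum>t<n. cost_mean t)) \<le> ereal (j + 2 * K / real n)" if "0 < n" for n
  proof -
    have "(\<Sum>t<n. cost_mean t) \<le> real n * j + 2 * K"
      using tot[of n] value_mean_bounded[of 0] value_mean_bounded[of n] by linarith
    then have "(\<Sum>t<n. cost_mean t) / real n \<le> (real n * j + 2 * K) / real n"
      by (intro divide_right_mono) auto
    then show ?thesis using that by (simp add: add_divide_distrib)
  qed
  then have "avg_cost S A T c x\<^sub>0 \<gamma> \<le> limsup (\<lambda>n. ereal (j + 2 * K / real n))"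
    unfolding avg_cost_def total_cost_mean
    by (intro Limsup_mono eventually_sequentiallyI[of 1]) auto
  moreover have "(\<lambda>n. ereal (j + 2 * K / real n)) \<longlonglongrightarrow> ereal (j + 0)"
    by (intro tendsto_intros tendsto_ereal lim_const_over_n)
  ultimately show ?thesis by (simp add: lim_imp_Limsup)
qed

end

end

section \<open>The optimal average cost from a bounded solution of the optimality equation\<close>

context finite_action_mdp
begin

text \<open>The infimum lies below every action, which gives the lower bound for all policies; a
  greedy measurable selector attains it, which gives the upper bound. Neither estimate depends on
  the initial state.\<close>

theorem opt_avg_cost_eq:
  assumes h: "h \<in> borel_measurable S" and bnd: "\<And>x. x \<in> space S \<Longrightarrow> \<bar>h x\<bar> \<le> K"
    and acoe: "\<And>x. x \<in> space S \<Longrightarrow> h x = (INF u\<in>space A. bellman h x u) - j"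
    and x\<^sub>0: "x\<^sub>0 \<in> space S"
  shows "opt_avg_cost S A T c x\<^sub>0 = ereal j"
proof (rule antisym)
  show "ereal j \<le> opt_avg_cost S A T c x\<^sub>0"
    unfolding opt_avg_cost_def
  proof (intro INF_greatest, clarify)
    fix \<gamma> :: "('x, 'u) policy" assume "admissible S A \<gamma>"
    then interpret controlled_mdp S A T c \<gamma> x\<^sub>0 using x\<^sub>0 by unfold_locales
    show "ereal j \<le> avg_cost S A T c x\<^sub>0 \<gamma>"
      using acoe INF_bellman_le[of _ h] by (intro avg_cost_ge[OF h bnd]) fastforce+
  qed
next
  obtain \<phi> where \<phi>: "\<phi> \<in> S \<rightarrow>\<^sub>M A" "\<And>x. x \<in> space S \<Longrightarrow> bellman h x (\<phi> x) = (INF u\<in>space A. bellman h x u)"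
    using bellman_selector[OF h] by blast
  let ?\<gamma> = "(\<lambda>t h x. \<phi> x) :: ('x, 'u) policy"
  have adm: "admissible S A ?\<gamma>"
    unfolding admissible_def using \<phi>(1) by (auto simp: case_prod_beta')
  then interpret controlled_mdp S A T c ?\<gamma> x\<^sub>0 using x\<^sub>0 by unfold_locales
  have "avg_cost S A T c x\<^sub>0 ?\<gamma> \<le> ereal j"
    by (rule avg_cost_le[OF h bnd _ \<phi>(1) refl]) (auto simp: \<phi>(2) acoe)
  then show "opt_avg_cost S A T c x\<^sub>0 \<le> ereal j"
    unfolding opt_avg_cost_def using adm by (intro INF_lower2[of ?\<gamma>]) auto
qed

end

section \<open>Value iteration under a minorization condition\<close>

locale minorized_mdp = finite_action_mdp S A T c
  for S :: "'x measure" and A :: "'u measure" and T c +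
  fixes \<mu> :: "'x measure"
  assumes sets_minor: "sets \<mu> = sets S"
    and minor_nonzero: "emeasure \<mu> (space S) \<noteq> 0"
    and minorization: "\<And>x u D. x \<in> space S \<Longrightarrow> u \<in> space A \<Longrightarrow> D \<in> sets S \<Longrightarrow> emeasure \<mu> D \<le> emeasure (T x u) D"
begin

lemma space_minor: "space \<mu> = space S"
  by (rule sets_eq_imp_space_eq[OF sets_minor])

text \<open>A measure below a probability kernel has mass at most 1; since \<open>\<mu>\<close> is
  nonzero, there is a state at which to compare.\<close>

lemma minor_le_one: "emeasure \<mu> (space S) \<le> 1"
proof -
  have "space S \<noteq> {}" using minor_nonzero by auto
  then obtain x u where xu: "x \<in> space S" "u \<in> space A" using actions_nonempty by auto
  then show ?thesis
    using minorization[OF xu sets.top] prob_space.emeasure_space_1[OF prob_space_kernel[OF xu]]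
    by (simp add: space_kernel)
qed

sublocale minor: finite_measure \<mu>
  using minor_le_one by (intro finite_measureI) (auto simp: space_minor top_unique)

definition mass :: real where "mass = measure \<mu> (space S)"

lemma mass_pos: "0 < mass" and mass_le_one: "mass \<le> 1"
  using minor_nonzero minor_le_one unfolding mass_def
  by (simp_all add: minor.emeasure_eq_measure zero_less_measure_iff)

lemma integrable_minor:
  fixes f :: "'x \<Rightarrow> real"
  assumes "f \<in> borel_measurable S" "\<And>x. x \<in> space S \<Longrightarrow> \<bar>f x\<bar> \<le> K"
  shows "integrable \<mu> f"
proof (rule minor.integrable_of_bounded)
  show "f \<in> borel_measurable \<mu>" using assms(1) by (simp cong: measurable_cong_sets add: sets_minor)
qed (use assms(2) in \<open>simp add: space_minor\<close>)

text \<open>\<open>T - \<mu>\<close> is a positive kernel: the nonnegative function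
  \<open>g - f\<close> integrates to at least as much under \<open>T x u\<close> as under
  \<open>\<mu>\<close>.\<close>

lemma kernel_minus_minor_mono:
  fixes f g :: "'x \<Rightarrow> real"
  assumes xu: "x \<in> space S" "u \<in> space A"
    and f: "f \<in> borel_measurable S" "\<And>x. x \<in> space S \<Longrightarrow> \<bar>f x\<bar> \<le> K"
    and g: "g \<in> borel_measurable S" "\<And>x. x \<in> space S \<Longrightarrow> \<bar>g x\<bar> \<le> L"
    and le: "\<And>x. x \<in> space S \<Longrightarrow> f x \<le> g x"
  shows "(\<integral>z. f z \<partial>T x u) - (\<integral>z. f z \<partial>\<mu>) \<le> (\<integral>z. g z \<partial>T x u) - (\<integral>z. g z \<partial>\<mu>)"
proof -
  have "(\<integral>z. g z - f z \<partial>\<mu>) \<le> (\<integral>z. g z - f z \<partial>T x u)"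
  proof (rule integral_mono_measure_real)
    show "finite_measure (T x u)" by (rule prob_space.finite_measure[OF prob_space_kernel[OF xu]])
    show "(\<lambda>z. g z - f z) \<in> borel_measurable (T x u)"
      unfolding measurable_cong_sets[OF sets_kernel[OF xu] refl] using f(1) g(1) by measurable
    show "g z - f z \<le> K + L" if "z \<in> space (T x u)" for z
      using f(2)[of z] g(2)[of z] that unfolding space_kernel[OF xu] by linarith
  qed (use minorization[OF xu] le in \<open>auto simp: sets_kernel[OF xu] space_kernel[OF xu] sets_minor\<close>)
  then show ?thesis
    using integrable_minor[OF f] integrable_minor[OF g] integrable_kernel[OF xu f] integrable_kernel[OF xu g]
    by simp
qed

text \<open>The Bellman expression of the sub-Markovian kernel \<open>T - \<mu>\<close>; with it the
  average-cost equation becomes a fixed-point equation.\<close>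

definition shifted_bellman :: "('x \<Rightarrow> real) \<Rightarrow> 'x \<Rightarrow> 'u \<Rightarrow> real" where
  "shifted_bellman f x u = bellman f x u - (\<integral>z. f z \<partial>\<mu>)"

lemma shifted_bellman_mono:
  assumes "x \<in> space S" "u \<in> space A"
    "f \<in> borel_measurable S" "\<And>x. x \<in> space S \<Longrightarrow> \<bar>f x\<bar> \<le> K"
    "g \<in> borel_measurable S" "\<And>x. x \<in> space S \<Longrightarrow> \<bar>g x\<bar> \<le> L"
    "\<And>x. x \<in> space S \<Longrightarrow> f x \<le> g x"
  shows "shifted_bellman f x u \<le> shifted_bellman g x u"
  using kernel_minus_minor_mono[OF assms] by (simp add: shifted_bellman_def bellman_def)

text \<open>\<open>T - \<mu>\<close> has total mass \<open>1 - mass\<close>, which is below 1 and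
  acts like a discount factor.\<close>

lemma shifted_bellman_const:
  assumes "x \<in> space S" "u \<in> space A"
  shows "shifted_bellman (\<lambda>_. R) x u = c x u + R * (1 - mass)"
  using prob_space.prob_space[OF prob_space_kernel[OF assms]]
  by (simp add: shifted_bellman_def bellman_def mass_def space_minor algebra_simps)

lemma INF_shifted_bellman:
  "(INF u\<in>space A. shifted_bellman f x u) = (INF u\<in>space A. bellman f x u) - (\<integral>z. f z \<partial>\<mu>)"
proof -
  have "(INF u\<in>space A. bellman f x u - (\<integral>z. f z \<partial>\<mu>)) = (INF u\<in>space A. bellman f x u) - (\<integral>z. f z \<partial>\<mu>)"
  proof -
    have fin: "finite (bellman f x ` space A)" "bellman f x ` space A \<noteq> {}"
      using finite_actions actions_nonempty by auto
    from Min_in[OF fin] obtain u where u: "u \<in> space A" "bellman f x u = Min (bellman f x ` space A)"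
      by (metis imageE)
    then have min: "bellman f x u \<le> bellman f x v" if "v \<in> space A" for v
      using fin that by simp
    have "(INF u\<in>space A. bellman f x u) = bellman f x u"
      using u(1) min by (intro cInf_eq_minimum) auto
    moreover have "(INF u\<in>space A. bellman f x u - (\<integral>z. f z \<partial>\<mu>)) = bellman f x u - (\<integral>z. f z \<partial>\<mu>)"
      using u(1) min by (intro cInf_eq_minimum) auto
    ultimately show ?thesis by simp
  qed
  then show ?thesis by (simp add: shifted_bellman_def)
qed

primrec value_iter :: "nat \<Rightarrow> 'x \<Rightarrow> real" where
  "value_iter 0 = (\<lambda>x. 0)"
| "value_iter (Suc n) = (\<lambda>x. INF u\<in>space A. shifted_bellman (value_iter n) x u)"

lemma value_iter_measurable: "value_iter n \<in> borel_measurable S"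
proof (induction n)
  case (Suc n)
  have "(\<lambda>x. shifted_bellman (value_iter n) x u) \<in> borel_measurable S" if [measurable]: "u \<in> space A" for u
    using measurable_compose[OF _ borel_measurable_bellman[OF Suc], of "\<lambda>x. (x, u)" S]
    by (simp add: shifted_bellman_def)
  then show ?case
    using finite_actions by (simp, intro borel_measurable_cINF countable_finite)
      (auto intro!: bounded_imp_bdd_below finite_imp_bounded)
qed simp

context
  fixes C :: real
  assumes C: "\<And>x u. x \<in> space S \<Longrightarrow> u \<in> space A \<Longrightarrow> 0 \<le> c x u \<and> c x u \<le> C"
begin

lemma bound_nonneg: "x \<in> space S \<Longrightarrow> 0 \<le> C / mass"
  using C[of x] actions_nonempty mass_pos by force

lemma value_iter_bounds: "x \<in> space S \<Longrightarrow> 0 \<le> value_iter n x \<and> value_iter n x \<le> C / mass"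
proof (induction n arbitrary: x)
  case 0
  then show ?case using bound_nonneg by simp
next
  case (Suc n)
  have bnd: "\<bar>value_iter n x\<bar> \<le> C / mass" if "x \<in> space S" for x using Suc.IH[OF that] by simp
  have "0 \<le> shifted_bellman (value_iter n) x u \<and> shifted_bellman (value_iter n) x u \<le> C / mass"
    if u: "u \<in> space A" for u
  proof
    have "shifted_bellman (\<lambda>_. 0) x u \<le> shifted_bellman (value_iter n) x u"
      by (rule shifted_bellman_mono[OF Suc.prems u _ _ value_iter_measurable bnd, of _ 0]) (auto simp: Suc.IH)
    then show "0 \<le> shifted_bellman (value_iter n) x u"
      using C[OF Suc.prems u] by (simp add: shifted_bellman_const[OF Suc.prems u])
    have "shifted_bellman (value_iter n) x u \<le> shifted_bellman (\<lambda>_. C / mass) x u"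
      by (rule shifted_bellman_mono[OF Suc.prems u value_iter_measurable bnd, of _ "\<bar>C / mass\<bar>"]) (auto simp: Suc.IH)
    also have "\<dots> \<le> C + C / mass * (1 - mass)"
      using C[OF Suc.prems u] by (simp add: shifted_bellman_const[OF Suc.prems u])
    \<comment> \<open>\<open>C / mass\<close> is the fixed point of
      \<open>R \<mapsto> C + R * (1 - mass)\<close>; this is where the upper bound comes
      from.\<close>
    also have "\<dots> = C / mass" using mass_pos by (simp add: field_simps)
    finally show "shifted_bellman (value_iter n) x u \<le> C / mass" .
  qed
  note bounds = this
  obtain u where u: "u \<in> space A" using actions_nonempty by auto
  have "value_iter (Suc n) x \<le> C / mass"
    unfolding value_iter.simps using bounds[OF u] finite_actions
    by (intro cINF_lower2[OF _ u]) (auto intro!: bounded_imp_bdd_below finite_imp_bounded)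
  moreover have "0 \<le> value_iter (Suc n) x"
    unfolding value_iter.simps using bounds actions_nonempty by (intro cINF_greatest) auto
  ultimately show ?case by simp
qed

lemma value_iter_abs: "x \<in> space S \<Longrightarrow> \<bar>value_iter n x\<bar> \<le> C / mass"
  using value_iter_bounds[of x n] by simp

text \<open>Starting at 0 with nonnegative costs gives the base case; monotonicity of the shifted
  operator carries the order upwards.\<close>

lemma value_iter_mono: "x \<in> space S \<Longrightarrow> value_iter n x \<le> value_iter (Suc n) x"
proof (induction n arbitrary: x)
  case 0
  then show ?case using value_iter_bounds[of x 1] by simp
next
  case (Suc n)
  have "shifted_bellman (value_iter n) x u \<le> shifted_bellman (value_iter (Suc n)) x u" if u: "u \<in> space A" for u
    by (rule shifted_bellman_mono[OF Suc.prems u value_iter_measurable value_iter_abs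
          value_iter_measurable value_iter_abs Suc.IH])
  then show ?case
    unfolding value_iter.simps(2)[of "Suc n"] unfolding value_iter.simps(2)[of n] 
    using actions_nonempty finite_actions
    by (intro cINF_mono) (auto intro!: bounded_imp_bdd_below finite_imp_bounded)
qed

text \<open>Increasing bounded iterates converge pointwise. Integrals pass to the limit by dominated
  convergence and the infimum does because there are finitely many actions, so the limit solves the
  equation.\<close>

theorem rel_value_exists: "\<exists>h. rel_value S (space A) T c \<mu> h"
proof
  let ?h = "\<lambda>x. lim (\<lambda>n. value_iter n x)"
  have conv: "(\<lambda>n. value_iter n x) \<longlonglongrightarrow> ?h x" if x: "x \<in> space S" for x
  proof -
    have "incseq (\<lambda>n. value_iter n x)" by (rule incseq_SucI) (rule value_iter_mono[OF x])
    then obtain l where "(\<lambda>n. value_iter n x) \<longlonglongrightarrow> l"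
      using incseq_convergent[of "\<lambda>n. value_iter n x" "C / mass"] value_iter_bounds[OF x] by metis
    then have "convergent (\<lambda>n. value_iter n x)" by (rule convergentI)
    then show ?thesis by (simp add: convergent_LIMSEQ_iff)
  qed
  have h: "?h \<in> borel_measurable S"
    by (rule borel_measurable_LIMSEQ_real[OF conv value_iter_measurable])
  have bnd: "\<bar>?h x\<bar> \<le> C / mass" if "x \<in> space S" for x
    using that by (intro LIMSEQ_le_const2[OF tendsto_rabs[OF conv]]) (auto simp: value_iter_abs)
  \<comment> \<open>The constant \<open>C / mass\<close> dominates all iterates; \<open>N\<close>
    will be both \<open>\<mu>\<close> and \<open>T x u\<close>.\<close>
  have lim_int: "(\<lambda>n. \<integral>z. value_iter n z \<partial>N) \<longlonglongrightarrow> (\<integral>z. ?h z \<partial>N)"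
    if N: "sets N = sets S" and "finite_measure N" for N
  proof -
    interpret finite_measure N by fact
    have sp: "space N = space S" by (rule sets_eq_imp_space_eq[OF N])
    show ?thesis
      using h value_iter_measurable conv value_iter_abs
      by (intro integral_dominated_convergence[where w="\<lambda>_. C / mass"])
         (auto simp: sp cong: measurable_cong_sets simp: N)
  qed
  have "?h x = (INF u\<in>space A. shifted_bellman ?h x u)" if x: "x \<in> space S" for x
  proof (rule LIMSEQ_unique)
    show "(\<lambda>n. value_iter (Suc n) x) \<longlonglongrightarrow> ?h x" using conv[OF x] by (rule LIMSEQ_Suc)
    have "(\<lambda>n. shifted_bellman (value_iter n) x u) \<longlonglongrightarrow> shifted_bellman ?h x u" if u: "u \<in> space A" for u
      unfolding shifted_bellman_def bellman_def
      by (intro tendsto_intros lim_int sets_minor minor.finite_measure_axioms sets_kernel[OF x u]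
            prob_space.finite_measure[OF prob_space_kernel[OF x u]])
    then show "(\<lambda>n. value_iter (Suc n) x) \<longlonglongrightarrow> (INF u\<in>space A. shifted_bellman ?h x u)"
      by (simp add: tendsto_INF_finite[OF finite_actions actions_nonempty])
  qed
  then show "rel_value S (space A) T c \<mu> ?h"
    unfolding rel_value_def using h bnd INF_shifted_bellman[of ?h] by (auto simp: bellman_def)
qed

end

section \<open>Arbitrary bounded solutions: optimal cost and a priori bound\<close>

lemma opt_avg_cost_rel_value:
  assumes "rel_value S (space A) T c \<mu> h" "x \<in> space S"
  shows "opt_avg_cost S A T c x = ereal (\<integral>x. h x \<partial>\<mu>)"
proof -
  obtain K where K: "\<And>x. x \<in> space S \<Longrightarrow> \<bar>h x\<bar> \<le> K" using assms(1) unfolding rel_value_def by blast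
  show ?thesis
    by (rule opt_avg_cost_eq[OF _ K _ assms(2)]) (use assms(1) in \<open>auto simp: rel_value_def bellman_def\<close>)
qed

text \<open>The error estimate concerns every bounded solution, so the bound is derived from the
  equation itself rather than from value iteration: the supremum norm satisfies
  \<open>R \<le> C + R * (1 - mass)\<close>, and \<open>mass > 0\<close> allows solving for
  \<open>R\<close>.\<close>

lemma rel_value_bound:
  assumes h: "rel_value S (space A) T c \<mu> h"
    and C: "\<And>x u. x \<in> space S \<Longrightarrow> u \<in> space A \<Longrightarrow> \<bar>c x u\<bar> \<le> C"
    and x: "x \<in> space S"
  shows "\<bar>h x\<bar> \<le> C / mass"
proof -
  obtain K where K: "\<And>x. x \<in> space S \<Longrightarrow> \<bar>h x\<bar> \<le> K" using h unfolding rel_value_def by blast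
  have m: "h \<in> borel_measurable S" using h by (simp add: rel_value_def)
  define R where "R = (SUP x\<in>space S. \<bar>h x\<bar>)"
  have bdd: "bdd_above ((\<lambda>x. \<bar>h x\<bar>) ` space S)" using K by (auto intro!: bdd_aboveI)
  have R: "\<bar>h x\<bar> \<le> R" if "x \<in> space S" for x unfolding R_def by (rule cSUP_upper[OF that bdd])
  have step: "\<bar>h x\<bar> \<le> C + R * (1 - mass)" if x: "x \<in> space S" for x
  proof -
    obtain u where u: "u \<in> space A" "bellman h x u = (INF u\<in>space A. bellman h x u)"
    proof -
      obtain f where "f \<in> S \<rightarrow>\<^sub>M A" "bellman h x (f x) = (INF u\<in>space A. bellman h x u)"
        using bellman_selector[OF m] x by metis
      then show thesis using x that measurable_space[of f S A x] by blast
    qed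
    have eq: "h x = shifted_bellman h x u"
      using h x u by (simp add: rel_value_def shifted_bellman_def bellman_def)
    \<comment> \<open>Sandwiching \<open>h\<close> between the constants \<open>- R\<close> and
      \<open>R\<close> bounds its integral against \<open>T - \<mu>\<close> by
      \<open>R * (1 - mass)\<close>.\<close>
    have "shifted_bellman h x u \<le> shifted_bellman (\<lambda>_. R) x u"
      using R by (intro shifted_bellman_mono[OF x u(1) m K, of _ "\<bar>R\<bar>"]) (auto simp: abs_le_iff)
    moreover have "shifted_bellman (\<lambda>_. - R) x u \<le> shifted_bellman h x u"
      using R by (intro shifted_bellman_mono[OF x u(1) _ _ m K, of _ "\<bar>R\<bar>"]) (auto simp: abs_le_iff minus_le_iff)
    ultimately show ?thesis
      using C[OF x u(1)] by (simp add: eq shifted_bellman_const[OF x u(1)] abs_le_iff)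
  qed
  have "R \<le> C + R * (1 - mass)" unfolding R_def[symmetric]
    by (subst R_def, rule cSUP_least) (use x step in auto)
  then have "R \<le> C / mass" using mass_pos by (simp add: field_simps)
  with R[OF x] show ?thesis by simp
qed

end

section \<open>The quantized model\<close>

text \<open>With all sets of actions measurable, pairs of a representative and an action form a
  discrete space, which settles measurability in the finite model.\<close>

locale quantized_mdp = minorized_mdp S A T c \<mu>
  for S :: "'x measure" and A :: "'u measure" and T c \<mu> +
  fixes \<pi> :: "'x measure" and M :: nat and B :: "nat \<Rightarrow> 'x set" and y :: "nat \<Rightarrow> 'x"
  assumes discrete_actions: "sets A = Pow (space A)"
    and sets_weight: "sets \<pi> = sets S" and prob_weight: "prob_space \<pi>"
    and bin_pos: "\<And>i. i \<in> {1..M} \<Longrightarrow> 0 < emeasure \<pi> (B i)"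
    and bin_sets: "\<And>i. i \<in> {1..M} \<Longrightarrow> B i \<in> sets S"
    and bins_disjoint: "disjoint_family_on B {1..M}"
    and bins_cover: "(\<Union>i\<in>{1..M}. B i) = space S"
    and reps: "\<And>i. i \<in> {1..M} \<Longrightarrow> y i \<in> B i"
begin

section \<open>Bins, representatives and weighting measures\<close>

abbreviation Y :: "'x set" where "Y \<equiv> y ` {1..M}"
abbreviation q :: "'x \<Rightarrow> 'x" where "q \<equiv> quantizer M B y"
abbreviation W :: "'x \<Rightarrow> 'x measure" where "W \<equiv> bin_weight M B \<pi>"

lemma bin_index_eq:
  assumes "i \<in> {1..M}" "x \<in> B i"
  shows "bin_index M B x = i"
  unfolding bin_index_def
proof (rule the_equality)
  show "k = i" if "k \<in> {1..M} \<and> x \<in> B k" for k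
    using that assms bins_disjoint unfolding disjoint_family_on_def by blast
qed (use assms in simp)

lemma bin_index:
  assumes "x \<in> space S"
  shows "bin_index M B x \<in> {1..M}" "x \<in> B (bin_index M B x)"
proof -
  obtain i where "i \<in> {1..M}" "x \<in> B i" using assms bins_cover by blast
  with bin_index_eq[OF this] show "bin_index M B x \<in> {1..M}" "x \<in> B (bin_index M B x)" by auto
qed

lemma rep_space: "i \<in> {1..M} \<Longrightarrow> y i \<in> space S"
  using reps bins_cover by blast

lemma Y_space: "z \<in> Y \<Longrightarrow> z \<in> space S"
  using rep_space by auto

lemma quantizer_in: "x \<in> space S \<Longrightarrow> q x \<in> Y"
  using bin_index by (auto simp: quantizer_def)

lemma bin_index_quantizer: "x \<in> space S \<Longrightarrow> bin_index M B (q x) = bin_index M B x"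
  unfolding quantizer_def by (intro bin_index_eq bin_index(1) reps)

lemma bin_of_quantizer: "x \<in> space S \<Longrightarrow> bin_of M B (q x) = bin_of M B x"
  by (simp add: bin_of_def bin_index_quantizer)

lemma weight_quantizer: "x \<in> space S \<Longrightarrow> W (q x) = W x"
  by (simp add: bin_weight_def bin_of_quantizer)

lemma bin_of_sets: "x \<in> space S \<Longrightarrow> bin_of M B x \<in> sets S"
  using bin_index bin_sets by (simp add: bin_of_def)

text \<open>Disjoint bins have distinct representatives, so the points sent to one representative
  are exactly its bin. This links entries of the finite model to events in the original
  space.\<close>

lemma quantizer_vimage: "z \<in> Y \<Longrightarrow> q -` {z} \<inter> space S = bin_of M B z"
proof -
  assume z: "z \<in> Y"
  then obtain i where i: "i \<in> {1..M}" "z = y i" by auto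
  have bi: "bin_of M B z = B i" unfolding i(2) bin_of_def by (simp only: bin_index_eq[OF i(1) reps[OF i(1)]])
  show ?thesis unfolding bi
  proof (intro equalityI subsetI)
    fix x assume "x \<in> q -` {z} \<inter> space S"
    then have x: "x \<in> space S" "q x = z" by auto
    have "bin_index M B x = i"
      using bin_index_quantizer[OF x(1)] bin_index_eq[OF i(1) reps[OF i(1)]] by (simp only: x(2) i(2))
    then show "x \<in> B i" using bin_index(2)[OF x(1)] by simp
  next
    fix x assume x: "x \<in> B i"
    then have "x \<in> space S" using i bins_cover by blast
    then show "x \<in> q -` {z} \<inter> space S" using bin_index_eq[OF i(1) x] i(2) by (simp add: quantizer_def)
  qed
qed

lemma quantizer_measurable[measurable]: "q \<in> S \<rightarrow>\<^sub>M count_space Y"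
  by (subst measurable_count_space_eq2) (use quantizer_in quantizer_vimage bin_of_sets Y_space in auto)

lemma quantizer_compose_measurable: "(\<lambda>x. f (q x) :: real) \<in> borel_measurable S"
  by (rule measurable_compose[OF quantizer_measurable]) simp

lemma
  assumes "x \<in> space S"
  shows sets_bin_weight: "sets (W x) = sets S" and space_bin_weight: "space (W x) = space S"
    and prob_bin_weight: "prob_space (W x)" and AE_bin_weight: "AE x' in W x. x' \<in> bin_of M B x"
proof -
  interpret \<pi>: prob_space \<pi> by (rule prob_weight)
  show s: "sets (W x) = sets S" by (simp add: bin_weight_def sets_weight)
  show "space (W x) = space S" by (rule sets_eq_imp_space_eq[OF s])
  have pos: "0 < emeasure \<pi> (bin_of M B x)" using bin_index[OF assms] bin_pos by (simp add: bin_of_def)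
  show "prob_space (W x)"
    unfolding bin_weight_def using pos by (intro prob_space_uniform_measure) auto
  show "AE x' in W x. x' \<in> bin_of M B x"
    unfolding bin_weight_def using bin_of_sets[OF assms]
    by (intro AE_uniform_measureI) (auto simp: sets_weight)
qed

text \<open>The weighting measure is concentrated on the bin, so the indicator equals 1 almost
  everywhere.\<close>

lemma set_integral_bin_weight:
  fixes f :: "'x \<Rightarrow> real"
  assumes x: "x \<in> space S" and f: "f \<in> borel_measurable S"
  shows "(LINT x':bin_of M B x|W x. f x') = (\<integral>x'. f x' \<partial>W x)"
  unfolding set_lebesgue_integral_def
proof (rule integral_cong_AE)
  show "(\<lambda>x'. indicator (bin_of M B x) x' *\<^sub>R f x') \<in> borel_measurable (W x)"
    "f \<in> borel_measurable (W x)"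
    unfolding measurable_cong_sets[OF sets_bin_weight[OF x] refl] using f bin_of_sets[OF x] by measurable
  show "AE x' in W x. indicator (bin_of M B x) x' *\<^sub>R f x' = f x'"
    using AE_bin_weight[OF x] by eventually_elim simp
qed

lemma section_kernel: "u \<in> space A \<Longrightarrow> (\<lambda>x. T x u) \<in> S \<rightarrow>\<^sub>M prob_algebra S"
  using measurable_compose[OF _ kernel, of "\<lambda>x. (x, u)" S] by simp

lemma section_cost: "u \<in> space A \<Longrightarrow> (\<lambda>x. c x u) \<in> borel_measurable S"
  using measurable_compose[OF _ cost_measurable, of "\<lambda>x. (x, u)" S] by simp

section \<open>Transition law, cost and minorization of the finite model\<close>

abbreviation finT where "finT \<equiv> fin_kernel M B y \<pi> T"
abbreviation finc where "finc \<equiv> fin_cost M B \<pi> c"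

text \<open>A finite transition draws a state from the bin weights, moves it by \<open>T\<close> and
  quantizes the result. In this form total mass, integrals and minorization all follow from facts
  about mixtures and images of measures.\<close>

lemma fin_kernel_eq:
  assumes z: "z \<in> Y" and u: "u \<in> space A"
  shows "finT z u = distr (W z \<bind> (\<lambda>x. T x u)) (count_space Y) q"
proof -
  have zS: "z \<in> space S" by (rule Y_space[OF z])
  interpret W: prob_space "W z" by (rule prob_bin_weight[OF zS])
  have kW: "(\<lambda>x. T x u) \<in> W z \<rightarrow>\<^sub>M subprob_algebra S"
    unfolding measurable_cong_sets[OF sets_bin_weight[OF zS] refl]
    by (rule measurable_prob_algebraD[OF section_kernel[OF u]])
  have sb: "sets (W z \<bind> (\<lambda>x. T x u)) = sets S"
    by (rule sets_bind) (use u W.not_empty in \<open>auto simp: space_bin_weight[OF zS] sets_kernel\<close>)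
  show ?thesis
  proof (rule measure_eqI_finite[of _ Y])
    \<comment> \<open>On a finite discrete space it suffices to compare singletons, whose preimages
      under \<open>q\<close> are bins.\<close>
    fix z' assume z': "z' \<in> Y"
    note bS = bin_of_sets[OF Y_space[OF z']]
    have m: "(\<lambda>x. measure (T x u) (bin_of M B z')) \<in> borel_measurable S"
      by (rule measurable_compose[OF section_kernel[OF u] measurable_measure_prob_algebra[OF bS]])
    have mW: "(\<lambda>x. measure (T x u) (bin_of M B z')) \<in> borel_measurable (W z)"
      using m by (simp cong: measurable_cong_sets add: sets_bin_weight[OF zS])
    have "emeasure (finT z u) {z'} = ennreal (fin_prob M B \<pi> T z' z u)"
      unfolding fin_kernel_def by (subst emeasure_point_measure_finite) (use z' in auto)
    also have "\<dots> = ennreal (\<integral>x. measure (T x u) (bin_of M B z') \<partial>W z)"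
      unfolding fin_prob_def using set_integral_bin_weight[OF zS m] by simp
    also have "\<dots> = (\<integral>\<^sup>+x. ennreal (measure (T x u) (bin_of M B z')) \<partial>W z)"
      by (rule nn_integral_eq_integral[symmetric], rule W.integrable_of_bounded[OF mW, of 1])
        (use u in \<open>auto simp: space_bin_weight[OF zS] prob_space.prob_le_1[OF prob_space_kernel]\<close>)
    also have "\<dots> = (\<integral>\<^sup>+x. emeasure (T x u) (bin_of M B z') \<partial>W z)"
      by (rule nn_integral_cong)
        (use u in \<open>simp add: space_bin_weight[OF zS] finite_measure.emeasure_eq_measure[OF prob_space.finite_measure[OF prob_space_kernel]]\<close>)
    also have "\<dots> = emeasure (W z \<bind> (\<lambda>x. T x u)) (bin_of M B z')"
      by (rule emeasure_bind[symmetric, OF W.not_empty kW bS])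
    also have "\<dots> = emeasure (distr (W z \<bind> (\<lambda>x. T x u)) (count_space Y) q) {z'}"
    proof (subst emeasure_distr)
      show "q \<in> (W z \<bind> (\<lambda>x. T x u)) \<rightarrow>\<^sub>M count_space Y"
        unfolding measurable_cong_sets[OF sb refl] by (rule quantizer_measurable)
    qed (use z' quantizer_vimage[OF z'] in \<open>simp_all add: sets_eq_imp_space_eq[OF sb]\<close>)
    finally show "emeasure (finT z u) {z'} = emeasure (distr (W z \<bind> (\<lambda>x. T x u)) (count_space Y) q) {z'}" .
  qed (auto simp: fin_kernel_def sets_point_measure)
qed

text \<open>The iterated integral serves the comparison with bin averages; the sum matches
  \<open>fin_rel_value\<close>.\<close>

lemma
  fixes f :: "'x \<Rightarrow> real"
  assumes z: "z \<in> Y" and u: "u \<in> space A"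
  shows prob_fin_kernel: "prob_space (finT z u)"
    and integral_fin_kernel: "(\<integral>z'. f z' \<partial>finT z u) = (\<integral>x. (\<integral>x'. f (q x') \<partial>T x u) \<partial>W z)"
    and integral_fin_kernel_sum: "(\<integral>z'. f z' \<partial>finT z u) = (\<Sum>z'\<in>Y. f z' * fin_prob M B \<pi> T z' z u)"
proof -
  have zS: "z \<in> space S" by (rule Y_space[OF z])
  interpret W: prob_space "W z" by (rule prob_bin_weight[OF zS])
  have kW: "(\<lambda>x. T x u) \<in> W z \<rightarrow>\<^sub>M prob_algebra S"
    using section_kernel[OF u] by (simp cong: measurable_cong_sets add: sets_bin_weight[OF zS])
  have sb: "sets (W z \<bind> (\<lambda>x. T x u)) = sets S"
    by (rule sets_bind) (use u W.not_empty in \<open>auto simp: space_bin_weight[OF zS] sets_kernel\<close>)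
  have qm: "q \<in> (W z \<bind> (\<lambda>x. T x u)) \<rightarrow>\<^sub>M count_space Y"
    unfolding measurable_cong_sets[OF sb refl] by (rule quantizer_measurable)
  have "prob_space (W z \<bind> (\<lambda>x. T x u))"
    by (rule W.prob_space_bind[where S=S])
      (use u measurable_prob_algebraD[OF kW] in \<open>auto simp: space_bin_weight[OF zS] prob_space_kernel\<close>)
  then show "prob_space (finT z u)"
    unfolding fin_kernel_eq[OF z u] by (rule prob_space.prob_space_distr[OF _ qm])
  have "(\<integral>z'. f z' \<partial>finT z u) = (\<integral>x. f (q x) \<partial>(W z \<bind> (\<lambda>x. T x u)))"
    unfolding fin_kernel_eq[OF z u] by (rule integral_distr[OF qm]) simp
  also have "\<dots> = (\<integral>x. (\<integral>x'. f (q x') \<partial>T x u) \<partial>W z)"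
  proof (rule integral_bind[where B="Max ((\<lambda>z. \<bar>f z\<bar>) ` Y)" and B'=1])
    show "\<bar>f (q x)\<bar> \<le> Max ((\<lambda>z. \<bar>f z\<bar>) ` Y)" if "x \<in> space S" for x
      using quantizer_in[OF that] by (intro Max_ge) auto
    show "AE x in W z. emeasure (T x u) (space (T x u)) \<le> ennreal 1"
      by (rule AE_I2) (use u in \<open>simp add: space_bin_weight[OF zS] prob_space.emeasure_space_1[OF prob_space_kernel]\<close>)
  qed (use measurable_prob_algebraD[OF kW] W.finite_measure_axioms quantizer_compose_measurable in auto)
  finally show "(\<integral>z'. f z' \<partial>finT z u) = (\<integral>x. (\<integral>x'. f (q x') \<partial>T x u) \<partial>W z)" .
  \<comment> \<open>\<open>point_measure\<close> takes its weights through \<open>ennreal\<close>,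
    which is faithful only on nonnegative values.\<close>
  have "0 \<le> fin_prob M B \<pi> T z' z u" for z'
    unfolding fin_prob_def set_lebesgue_integral_def by (rule Bochner_Integration.integral_nonneg) simp
  then show "(\<integral>z'. f z' \<partial>finT z u) = (\<Sum>z'\<in>Y. f z' * fin_prob M B \<pi> T z' z u)"
    unfolding fin_kernel_def by (subst lebesgue_integral_point_measure_finite) (auto simp: mult.commute)
qed

lemma fin_cost_eq: "z \<in> space S \<Longrightarrow> u \<in> space A \<Longrightarrow> finc z u = (\<integral>x. c x u \<partial>W z)"
  unfolding fin_cost_def by (intro set_integral_bin_weight section_cost)

lemma fin_cost_le:
  assumes z: "z \<in> space S" and u: "u \<in> space A" and C: "\<And>x. x \<in> space S \<Longrightarrow> \<bar>c x u\<bar> \<le> C"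
  shows "\<bar>finc z u\<bar> \<le> C"
proof -
  interpret W: prob_space "W z" by (rule prob_bin_weight[OF z])
  have m: "(\<lambda>x. c x u) \<in> borel_measurable (W z)"
    using section_cost[OF u] by (simp cong: measurable_cong_sets add: sets_bin_weight[OF z])
  have i: "integrable (W z) (\<lambda>x. c x u)"
    by (rule W.integrable_of_bounded[OF m, of C]) (simp add: space_bin_weight[OF z] C)
  have "\<bar>\<integral>x. c x u \<partial>W z\<bar> \<le> (\<integral>x. \<bar>c x u\<bar> \<partial>W z)" by (rule integral_abs_bound)
  also have "\<dots> \<le> (\<integral>x. C \<partial>W z)"
    using i C by (intro integral_mono integrable_abs) (simp_all add: space_bin_weight[OF z])
  also have "\<dots> = C" by (simp add: W.prob_space)
  finally show ?thesis by (simp add: fin_cost_eq[OF z u])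
qed

lemma sets_finite_pair: "sets (count_space Y \<Otimes>\<^sub>M A) = sets (count_space (Y \<times> space A))"
proof -
  have "sets (count_space Y \<Otimes>\<^sub>M A) = sets (count_space Y \<Otimes>\<^sub>M count_space (space A))"
    by (rule sets_pair_measure_cong) (simp_all add: discrete_actions)
  also have "count_space Y \<Otimes>\<^sub>M count_space (space A) = count_space (Y \<times> space A)"
    by (rule pair_measure_count_space) (simp_all add: finite_actions)
  finally show ?thesis .
qed

abbreviation minorY :: "'x measure" where "minorY \<equiv> distr \<mu> (count_space Y) q"

lemma quantizer_measurable_minor: "q \<in> \<mu> \<rightarrow>\<^sub>M count_space Y"
  unfolding measurable_cong_sets[OF sets_minor refl] by (rule quantizer_measurable)

text \<open>The original minorization is applied to the preimage of a set under \<open>q\<close> and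
  then averaged over the bin weights.\<close>

lemma minorized_finite_model: "minorized_mdp (count_space Y) A finT finc minorY"
proof
  show "(\<lambda>(z, u). finT z u) \<in> count_space Y \<Otimes>\<^sub>M A \<rightarrow>\<^sub>M prob_algebra (count_space Y)"
    unfolding measurable_cong_sets[OF sets_finite_pair refl]
    using prob_fin_kernel by (auto simp: space_prob_algebra fin_kernel_def sets_point_measure)
  show "(\<lambda>(z, u). finc z u) \<in> borel_measurable (count_space Y \<Otimes>\<^sub>M A)"
    unfolding measurable_cong_sets[OF sets_finite_pair refl] by simp
  show "\<exists>K. \<forall>z\<in>space (count_space Y). \<forall>u\<in>space A. \<bar>finc z u\<bar> \<le> K"
    using cost_bounded fin_cost_le Y_space by (metis space_count_space)
  show "emeasure minorY (space (count_space Y)) \<noteq> 0"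
  proof -
    have "q -` Y \<inter> space S = space S" using quantizer_in by auto
    then show ?thesis using minor_nonzero
      by (subst emeasure_distr[OF quantizer_measurable_minor]) (simp_all add: space_minor)
  qed
  fix z u D assume z: "z \<in> space (count_space Y)" and u: "u \<in> space A" and D: "D \<in> sets (count_space Y)"
  then have zY: "z \<in> Y" and zS: "z \<in> space S" by (auto intro: Y_space)
  interpret W: prob_space "W z" by (rule prob_bin_weight[OF zS])
  have kW: "(\<lambda>x. T x u) \<in> W z \<rightarrow>\<^sub>M subprob_algebra S"
    using measurable_prob_algebraD[OF section_kernel[OF u]]
    by (simp cong: measurable_cong_sets add: sets_bin_weight[OF zS])
  have sb: "sets (W z \<bind> (\<lambda>x. T x u)) = sets S"
    by (rule sets_bind) (use u W.not_empty in \<open>auto simp: space_bin_weight[OF zS] sets_kernel\<close>)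
  have qm: "q \<in> (W z \<bind> (\<lambda>x. T x u)) \<rightarrow>\<^sub>M count_space Y"
    unfolding measurable_cong_sets[OF sb refl] by (rule quantizer_measurable)
  let ?D = "q -` D \<inter> space S"
  have DS: "?D \<in> sets S" by (rule measurable_sets[OF quantizer_measurable D])
  have "emeasure minorY D = (\<integral>\<^sup>+x. emeasure \<mu> ?D \<partial>W z)"
    unfolding emeasure_distr[OF quantizer_measurable_minor D] by (simp add: space_minor W.emeasure_space_1)
  also have "\<dots> \<le> (\<integral>\<^sup>+x. emeasure (T x u) ?D \<partial>W z)"
    by (rule nn_integral_mono) (use u DS minorization in \<open>auto simp: space_bin_weight[OF zS]\<close>)
  also have "\<dots> = emeasure (W z \<bind> (\<lambda>x. T x u)) ?D"
    by (rule emeasure_bind[symmetric, OF W.not_empty kW DS])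
  also have "\<dots> = emeasure (finT z u) D"
    unfolding fin_kernel_eq[OF zY u] emeasure_distr[OF qm D] sets_eq_imp_space_eq[OF sb] ..
  finally show "emeasure minorY D \<le> emeasure (finT z u) D" .
qed (simp_all add: finite_actions actions_nonempty)

sublocale fin: minorized_mdp "count_space Y" A finT finc minorY
  by (rule minorized_finite_model)

text \<open>Quantization loses no mass, so the a priori bounds of both models share the constant
  \<open>C / mass\<close>.\<close>

lemma fin_mass: "fin.mass = mass"
proof -
  have "q -` Y \<inter> space S = space S" using quantizer_in by auto
  then show ?thesis
    unfolding fin.mass_def mass_def
    by (subst measure_distr[OF quantizer_measurable_minor]) (simp_all add: space_minor)
qed

lemma integral_minorY: "(\<integral>z. f z \<partial>minorY) = (\<integral>x. f (q x) \<partial>\<mu>)"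
  for f :: "'x \<Rightarrow> real"
  by (rule integral_distr[OF quantizer_measurable_minor]) simp

text \<open>Measurability and boundedness are automatic on a finite discrete space, so the general
  theory applies to every \<open>hh\<close>.\<close>

lemma fin_rel_value_iff:
  "fin_rel_value M B y \<pi> (space A) T c \<mu> f \<longleftrightarrow> rel_value (count_space Y) (space A) finT finc minorY f"
proof -
  have "\<exists>K. \<forall>z\<in>Y. \<bar>f z\<bar> \<le> K" by (intro exI[of _ "Max ((\<lambda>z. \<bar>f z\<bar>) ` Y)"]) auto
  moreover have "(INF u\<in>space A. finc z u + (\<Sum>z'\<in>Y. f z' * fin_prob M B \<pi> T z' z u)) =
      (INF u\<in>space A. finc z u + (\<integral>z'. f z' \<partial>finT z u))" if "z \<in> Y" for z
    by (rule INF_cong) (simp_all add: integral_fin_kernel_sum[OF that])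
  ultimately show ?thesis
    unfolding fin_rel_value_def rel_value_def integral_minorY space_count_space by auto
qed

end

section \<open>The error bound\<close>

text \<open>Invariance on sets is an equality of \<open>\<rho>\<close> with its own mixture of
  transition laws; integrating \<open>f\<close> against both sides gives the claim.\<close>

lemma invariant_prob_integral:
  fixes f :: "'x \<Rightarrow> real"
  assumes inv: "invariant_prob S T \<phi> \<rho>"
    and k: "(\<lambda>x. T x (\<phi> x)) \<in> S \<rightarrow>\<^sub>M prob_algebra S"
    and f: "f \<in> borel_measurable S" "\<And>x. x \<in> space S \<Longrightarrow> \<bar>f x\<bar> \<le> K"
  shows "(\<integral>x. (\<integral>z. f z \<partial>T x (\<phi> x)) \<partial>\<rho>) = (\<integral>x. f x \<partial>\<rho>)"
proof -
  have s: "sets \<rho> = sets S" and p: "prob_space \<rho>" using inv by (auto simp: invariant_prob_def)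
  interpret prob_space \<rho> by (rule p)
  have sp: "space \<rho> = space S" by (rule sets_eq_imp_space_eq[OF s])
  have k\<rho>: "(\<lambda>x. T x (\<phi> x)) \<in> \<rho> \<rightarrow>\<^sub>M subprob_algebra S"
    unfolding measurable_cong_sets[OF s refl] by (rule measurable_prob_algebraD[OF k])
  have kp: "prob_space (T x (\<phi> x))" "sets (T x (\<phi> x)) = sets S" if "x \<in> space S" for x
    using measurable_space[OF k that] by (auto simp: space_prob_algebra)
  have "\<rho> \<bind> (\<lambda>x. T x (\<phi> x)) = \<rho>"
  proof (rule measure_eqI)
    show sb: "sets (\<rho> \<bind> (\<lambda>x. T x (\<phi> x))) = sets \<rho>"
      unfolding s by (rule sets_bind) (use kp not_empty in \<open>auto simp: sp\<close>)
    fix D assume "D \<in> sets (\<rho> \<bind> (\<lambda>x. T x (\<phi> x)))"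
    then have D: "D \<in> sets S" by (simp add: sb s)
    show "emeasure (\<rho> \<bind> (\<lambda>x. T x (\<phi> x))) D = emeasure \<rho> D"
      using inv D by (subst emeasure_bind[OF not_empty k\<rho> D]) (simp add: invariant_prob_def)
  qed
  then have "(\<integral>x. f x \<partial>\<rho>) = (\<integral>x. f x \<partial>(\<rho> \<bind> (\<lambda>x. T x (\<phi> x))))" by simp
  also have "\<dots> = (\<integral>x. (\<integral>z. f z \<partial>T x (\<phi> x)) \<partial>\<rho>)"
    by (rule integral_bind[OF f k\<rho>, where B'=1])
      (use kp in \<open>auto simp: finite_measure_axioms sp prob_space.emeasure_space_1 intro!: AE_I2\<close>)
  finally show ?thesis by simp
qed

context quantized_mdp
begin

text \<open>The gap between a value and its bin average is at most the average of the gaps. With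
  \<open>d\<close> the \<open>l1_norm\<close> distance the right side is \<open>K\<close> times the
  loss at \<open>x\<close>.\<close>

lemma bin_average_error:
  fixes f d :: "'x \<Rightarrow> real"
  assumes x: "x \<in> space S"
    and f: "f \<in> borel_measurable S" "\<And>x'. x' \<in> space S \<Longrightarrow> \<bar>f x'\<bar> \<le> L"
    and d: "d \<in> borel_measurable S" and K: "0 \<le> K"
    and le: "\<And>x'. x' \<in> space S \<Longrightarrow> \<bar>f x - f x'\<bar> \<le> K * d x'"
  shows "ennreal \<bar>f x - (\<integral>x'. f x' \<partial>W x)\<bar> \<le> ennreal K * (\<integral>\<^sup>+x'\<in>bin_of M B x. ennreal (d x') \<partial>W x)"
proof -
  note cong = measurable_cong_sets[OF sets_bin_weight[OF x] refl]
  interpret W: prob_space "W x" by (rule prob_bin_weight[OF x])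
  have i: "integrable (W x) f"
    using f by (intro W.integrable_of_bounded[of _ L]) (simp_all add: cong space_bin_weight[OF x])
  have "f x - (\<integral>x'. f x' \<partial>W x) = (\<integral>x'. f x - f x' \<partial>W x)"
    using i by (simp add: W.prob_space)
  then have "ennreal \<bar>f x - (\<integral>x'. f x' \<partial>W x)\<bar> \<le> (\<integral>\<^sup>+x'. ennreal \<bar>f x - f x'\<bar> \<partial>W x)"
    using integral_norm_bound_ennreal[of "W x" "\<lambda>x'. f x - f x'"] i by (simp add: W.prob_space)
  also have "\<dots> \<le> (\<integral>\<^sup>+x'. ennreal K * (ennreal (d x') * indicator (bin_of M B x) x') \<partial>W x)"
  proof (rule nn_integral_mono_AE)
    show "AE x' in W x. ennreal \<bar>f x - f x'\<bar> \<le> ennreal K * (ennreal (d x') * indicator (bin_of M B x) x')"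
      using AE_bin_weight[OF x] AE_space
    proof eventually_elim
      case (elim x')
      then have "ennreal \<bar>f x - f x'\<bar> \<le> ennreal (K * d x')"
        using le[of x'] by (intro ennreal_leI) (simp add: space_bin_weight[OF x])
      then show ?case using elim K by (simp add: ennreal_mult')
    qed
  qed
  also have "\<dots> = ennreal K * (\<integral>\<^sup>+x'\<in>bin_of M B x. ennreal (d x') \<partial>W x)"
    by (rule nn_integral_cmult) (use d bin_of_sets[OF x] in \<open>simp add: cong\<close>)
  finally show ?thesis .
qed

text \<open>The minimizer of each optimality equation is tested in the other. \<open>E\<close>
  absorbs the gap between a point and its bin average; positivity of \<open>T - \<mu>\<close>
  controls the propagated difference.\<close>

lemma rel_value_error:
  assumes h: "rel_value S (space A) T c \<mu> h"
    and hh: "fin_rel_value M B y \<pi> (space A) T c \<mu> hh"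
    and x: "x \<in> space S"
    and V: "\<And>u. u \<in> space A \<Longrightarrow> (\<integral>z. \<bar>h z - hh (q z)\<bar> \<partial>T x u) \<le> V"
    and E: "\<And>u. u \<in> space A \<Longrightarrow>
      \<bar>bellman (\<lambda>z. hh (q z)) x u - (\<integral>x'. bellman (\<lambda>z. hh (q z)) x' u \<partial>W x)\<bar> \<le> E"
  shows "\<bar>h x - hh (q x)\<bar> \<le> E + V - (\<integral>z. \<bar>h z - hh (q z)\<bar> \<partial>\<mu>)"
proof -
  let ?f = "\<lambda>z. hh (q z)" and ?g = "\<lambda>z. h z - hh (q z)"
  have rhh: "rel_value (count_space Y) (space A) finT finc minorY hh"
    using hh by (simp add: fin_rel_value_iff)
  obtain H where H: "\<And>x. x \<in> space S \<Longrightarrow> \<bar>h x\<bar> \<le> H" using h unfolding rel_value_def by blast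
  obtain F where F: "\<And>z. z \<in> Y \<Longrightarrow> \<bar>hh z\<bar> \<le> F" using rhh unfolding rel_value_def space_count_space by blast
  have hm: "h \<in> borel_measurable S" using h by (simp add: rel_value_def)
  have fm: "?f \<in> borel_measurable S" by (rule quantizer_compose_measurable)
  have fb: "\<bar>?f z\<bar> \<le> F" if "z \<in> space S" for z using F[OF quantizer_in[OF that]] .
  have gm: "?g \<in> borel_measurable S" using hm fm by simp
  have gb: "\<bar>?g z\<bar> \<le> H + F" if "z \<in> space S" for z using H[OF that] fb[OF that] by linarith
  have am: "(\<lambda>z. \<bar>?g z\<bar>) \<in> borel_measurable S" using gm by simp
  have ab: "\<bar>\<bar>?g z\<bar>\<bar> \<le> H + F" if "z \<in> space S" for z using gb[OF that] by simp
  have nm: "(\<lambda>z. - ?g z) \<in> borel_measurable S" by (rule borel_measurable_uminus[OF gm])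
  have nb: "\<bar>- ?g z\<bar> \<le> H + F" if "z \<in> space S" for z using gb[OF that] by simp
  have qx: "q x \<in> Y" by (rule quantizer_in[OF x])
  \<comment> \<open>The finite Bellman expression is the bin average of the original one for the
    extended function; this makes the two equations comparable.\<close>
  have fin_bellman: "fin.bellman hh (q x) u = (\<integral>x'. bellman ?f x' u \<partial>W x)" if u: "u \<in> space A" for u
  proof -
    note cong = measurable_cong_sets[OF sets_bin_weight[OF x] refl]
    interpret W: prob_space "W x" by (rule prob_bin_weight[OF x])
    obtain C where C: "\<And>x u. x \<in> space S \<Longrightarrow> u \<in> space A \<Longrightarrow> \<bar>c x u\<bar> \<le> C"
      using cost_bounded by blast
    have "integrable (W x) (\<lambda>x'. c x' u)"
      using section_cost[OF u] C u
      by (intro W.integrable_of_bounded[of _ C]) (simp_all add: cong space_bin_weight[OF x])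
    moreover have "integrable (W x) (\<lambda>x'. \<integral>z. ?f z \<partial>T x' u)"
    proof (rule W.integrable_of_bounded[of _ F])
      show "(\<lambda>x'. \<integral>z. ?f z \<partial>T x' u) \<in> borel_measurable (W x)"
        unfolding cong
        by (rule measurable_compose[OF measurable_prob_algebraD[OF section_kernel[OF u]]
              integral_measurable_subprob_algebra[OF fm]])
    qed (use integral_kernel_bounded[OF _ u fm fb] in \<open>simp add: space_bin_weight[OF x]\<close>)
    ultimately show ?thesis
      unfolding fin.bellman_def bellman_def
      by (simp add: fin_cost_eq[OF Y_space[OF qx] u] integral_fin_kernel[OF qx u] weight_quantizer[OF x])
  qed
  have eq_h: "h x = (INF u\<in>space A. bellman h x u) - (\<integral>z. h z \<partial>\<mu>)"
    using h x by (simp add: rel_value_def bellman_def)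
  have eq_hh: "hh (q x) = (INF u\<in>space A. fin.bellman hh (q x) u) - (\<integral>z. ?f z \<partial>\<mu>)"
    using rhh qx unfolding rel_value_def fin.bellman_def integral_minorY space_count_space by blast
  have mu_diff: "(\<integral>z. ?g z \<partial>\<mu>) = (\<integral>z. h z \<partial>\<mu>) - (\<integral>z. ?f z \<partial>\<mu>)"
    by (intro Bochner_Integration.integral_diff integrable_minor[OF hm H] integrable_minor[OF fm fb])
  have diff: "bellman h x u - bellman ?f x u = (\<integral>z. ?g z \<partial>T x u)" if u: "u \<in> space A" for u
    unfolding bellman_def
    by (subst Bochner_Integration.integral_diff) (auto intro: integrable_kernel[OF x u hm H] integrable_kernel[OF x u fm fb])
  let ?B = "V - (\<integral>z. \<bar>?g z\<bar> \<partial>\<mu>)"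
  \<comment> \<open>The difference and its negative both lie below the absolute value, and
    \<open>T - \<mu>\<close> preserves order.\<close>
  have up: "(\<integral>z. ?g z \<partial>T x u) - (\<integral>z. ?g z \<partial>\<mu>) \<le> ?B" if u: "u \<in> space A" for u
    using kernel_minus_minor_mono[OF x u gm gb am ab abs_ge_self] V[OF u] by linarith
  have lo: "- (\<integral>z. ?g z \<partial>T x u) + (\<integral>z. ?g z \<partial>\<mu>) \<le> ?B" if u: "u \<in> space A" for u
    using kernel_minus_minor_mono[OF x u nm nb am ab abs_ge_minus_self] V[OF u]
    unfolding integral_minus by linarith
  have attained: "\<exists>u\<in>space A. G u = (INF u\<in>space A. G u)" for G :: "'u \<Rightarrow> real"
  proof -
    have "(INF u\<in>space A. G u) = Min (G ` space A)"
      using finite_actions actions_nonempty by (intro cInf_eq_Min) auto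
    also have "\<dots> \<in> G ` space A"
      using finite_actions actions_nonempty by (intro Min_in) auto
    finally show ?thesis by auto
  qed
  \<comment> \<open>A minimizer of the finite equation, tested in the original one, gives the upper
    estimate; for the lower one the roles are exchanged.\<close>
  obtain u where u: "u \<in> space A" "fin.bellman hh (q x) u = (INF u\<in>space A. fin.bellman hh (q x) u)"
    using attained by blast
  have "h x - hh (q x) \<le> E + ?B"
    using INF_bellman_le[OF u(1), of h x] eq_h eq_hh u(2) up[OF u(1)] E[OF u(1)] diff[OF u(1)] mu_diff
      fin_bellman[OF u(1)] by linarith
  moreover obtain v where v: "v \<in> space A" "bellman h x v = (INF u\<in>space A. bellman h x u)"
    using attained by blast
  have "hh (q x) - h x \<le> E + ?B"
    using fin.INF_bellman_le[OF v(1), of hh "q x"] eq_h eq_hh v(2) lo[OF v(1)] E[OF v(1)] diff[OF v(1)] mu_diff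
      fin_bellman[OF v(1)] by linarith
  ultimately show ?thesis by linarith
qed

text \<open>The pointwise estimate is integrated against \<open>\<rho>\<close>. By invariance the
  absolute difference and its one-step expectation under \<open>\<phi>\<close> have equal integrals
  and cancel, leaving the \<open>\<mu>\<close>-integral.\<close>

theorem average_cost_error:
  fixes d :: "'x \<Rightarrow> 'x \<Rightarrow> real"
  assumes h: "rel_value S (space A) T c \<mu> h"
    and hh: "fin_rel_value M B y \<pi> (space A) T c \<mu> hh"
    and \<phi>: "\<phi> \<in> S \<rightarrow>\<^sub>M A"
    and max: "\<And>x u. x \<in> space S \<Longrightarrow> u \<in> space A \<Longrightarrow>
      (\<integral>z. \<bar>h z - hh (q z)\<bar> \<partial>T x u) \<le> (\<integral>z. \<bar>h z - hh (q z)\<bar> \<partial>T x (\<phi> x))"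
    and inv: "invariant_prob S T \<phi> \<rho>"
    and K: "0 < K"
    and d: "\<And>x. x \<in> space S \<Longrightarrow> d x \<in> borel_measurable S"
    and Lip: "\<And>x x' u. x \<in> space S \<Longrightarrow> x' \<in> space S \<Longrightarrow> u \<in> space A \<Longrightarrow>
      \<bar>bellman (\<lambda>z. hh (q z)) x u - bellman (\<lambda>z. hh (q z)) x' u\<bar> \<le> K * d x x'"
  shows "ereal \<bar>(\<integral>z. h z \<partial>\<mu>) - (\<integral>z. hh (q z) \<partial>\<mu>)\<bar>
    \<le> ereal K * enn2ereal (\<integral>\<^sup>+x. (\<integral>\<^sup>+x'\<in>bin_of M B x. ennreal (d x x') \<partial>W x) \<partial>\<rho>)"
proof -
  let ?f = "\<lambda>z. hh (q z)" and ?g = "\<lambda>z. \<bar>h z - hh (q z)\<bar>"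
  let ?L = "\<lambda>x. \<integral>\<^sup>+x'\<in>bin_of M B x. ennreal (d x x') \<partial>W x"
  have rhh: "rel_value (count_space Y) (space A) finT finc minorY hh"
    using hh by (simp add: fin_rel_value_iff)
  obtain H where H: "\<And>x. x \<in> space S \<Longrightarrow> \<bar>h x\<bar> \<le> H" using h unfolding rel_value_def by blast
  obtain F where F: "\<And>z. z \<in> Y \<Longrightarrow> \<bar>hh z\<bar> \<le> F"
    using rhh unfolding rel_value_def space_count_space by blast
  obtain C where C: "\<And>x u. x \<in> space S \<Longrightarrow> u \<in> space A \<Longrightarrow> \<bar>c x u\<bar> \<le> C"
    using cost_bounded by blast
  have hm: "h \<in> borel_measurable S" using h by (simp add: rel_value_def)
  have fm: "?f \<in> borel_measurable S" by (rule quantizer_compose_measurable)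
  have fb: "\<bar>?f z\<bar> \<le> F" if "z \<in> space S" for z using F[OF quantizer_in[OF that]] .
  have gm: "?g \<in> borel_measurable S" using hm fm by simp
  have gb: "\<bar>?g z\<bar> \<le> H + F" if "z \<in> space S" for z using H[OF that] fb[OF that] by linarith
  have \<phi>A: "\<phi> x \<in> space A" if "x \<in> space S" for x using measurable_space[OF \<phi> that] .
  define G where "G x = (\<integral>z. ?g z \<partial>T x (\<phi> x))" for x
  define m where "m = (\<integral>z. ?g z \<partial>\<mu>)"
  have k: "(\<lambda>x. T x (\<phi> x)) \<in> S \<rightarrow>\<^sub>M prob_algebra S"
    using measurable_compose[OF measurable_Pair[OF measurable_ident \<phi>] kernel] by simp
  have Gm: "G \<in> borel_measurable S"
    unfolding G_def[abs_def]
    by (rule measurable_compose[OF measurable_prob_algebraD[OF k] integral_measurable_subprob_algebra[OF gm]])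
  have Gb: "\<bar>G x\<bar> \<le> H + F" if "x \<in> space S" for x
    unfolding G_def by (rule integral_kernel_bounded[OF that \<phi>A[OF that] gm gb])
  have s: "sets \<rho> = sets S" and p: "prob_space \<rho>" using inv by (auto simp: invariant_prob_def)
  interpret \<rho>: prob_space \<rho> by (rule p)
  have sp: "space \<rho> = space S" by (rule sets_eq_imp_space_eq[OF s])
  have ig: "integrable \<rho> ?g"
    by (rule \<rho>.integrable_of_bounded[of _ "H + F"]) (use gm gb in \<open>simp_all add: sp measurable_cong_sets[OF s refl]\<close>)
  have iG: "integrable \<rho> G"
    by (rule \<rho>.integrable_of_bounded[of _ "H + F"]) (use Gm Gb in \<open>simp_all add: sp measurable_cong_sets[OF s refl]\<close>)
  have "(\<integral>x. G x \<partial>\<rho>) = (\<integral>x. ?g x \<partial>\<rho>)"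
    unfolding G_def by (rule invariant_prob_integral[OF inv k gm gb])
  \<comment> \<open>The inner loss integral is only bounded below by a measurable function, so its own measurability in \<open>x\<close> plays no role.\<close>
  then have "m / K = (\<integral>x. (?g x - G x + m) / K \<partial>\<rho>)"
    using ig iG by (simp add: \<rho>.prob_space)
  then have "ennreal (m / K) \<le> (\<integral>\<^sup>+x. ennreal ((?g x - G x + m) / K) \<partial>\<rho>)"
    using ig iG by (simp only:) (intro ennreal_integral_le_nn_integral integrable_divide_zero; simp)
  also have "\<dots> \<le> (\<integral>\<^sup>+x. ?L x \<partial>\<rho>)"
  proof (rule nn_integral_mono)
    fix x assume "x \<in> space \<rho>"
    then have x: "x \<in> space S" by (simp add: sp)
    let ?e = "\<lambda>u. \<bar>bellman ?f x u - (\<integral>x'. bellman ?f x' u \<partial>W x)\<bar>"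
    \<comment> \<open>One action attains the largest averaging error, so the estimate for that
      action alone bounds \<open>E\<close>.\<close>
    define E where "E = Max (?e ` space A)"
    have E: "?e u \<le> E" if "u \<in> space A" for u
      unfolding E_def using finite_actions that by (intro Max_ge) auto
    have "E \<in> ?e ` space A"
      unfolding E_def using finite_actions actions_nonempty by (intro Max_in) auto
    then obtain u where u: "u \<in> space A" "E = ?e u" by blast
    have bm: "(\<lambda>x'. bellman ?f x' u) \<in> borel_measurable S"
      using measurable_compose[OF _ borel_measurable_bellman[OF fm], of "\<lambda>x. (x, u)" S] u by simp
    have bb: "\<bar>bellman ?f x' u\<bar> \<le> C + F" if "x' \<in> space S" for x'
      unfolding bellman_def using C[OF that u(1)] integral_kernel_bounded[OF that u(1) fm fb] by linarith
    have "ennreal E \<le> ennreal K * ?L x"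
      unfolding u(2) by (rule bin_average_error[OF x bm bb d[OF x] less_imp_le[OF K] Lip[OF x _ u(1)]])
    \<comment> \<open>Maximality of \<open>\<phi>\<close> allows the choice
      \<open>V = G x\<close>.\<close>
    moreover have "?g x - G x + m \<le> E"
      using rel_value_error[OF h hh x max[OF x] E] by (simp add: G_def m_def)
    ultimately have "ennreal (?g x - G x + m) \<le> ennreal K * ?L x"
      by (meson ennreal_leI order_trans)
    \<comment> \<open>Cancelling \<open>K\<close> at each point keeps the constant out of the outer
      integral.\<close>
    then have "ennreal (1 / K) * ennreal (?g x - G x + m) \<le> ennreal (1 / K) * (ennreal K * ?L x)"
      by (rule mult_left_mono) simp
    then show "ennreal ((?g x - G x + m) / K) \<le> ?L x"
      using K by (simp add: mult.assoc[symmetric] ennreal_mult'[symmetric])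
  qed
  finally have le: "ennreal (m / K) \<le> (\<integral>\<^sup>+x. ?L x \<partial>\<rho>)" .
  have "\<bar>(\<integral>z. h z \<partial>\<mu>) - (\<integral>z. ?f z \<partial>\<mu>)\<bar> = \<bar>\<integral>z. h z - ?f z \<partial>\<mu>\<bar>"
    using integrable_minor[OF hm H] integrable_minor[OF fm fb] by simp
  also have "\<dots> \<le> m" unfolding m_def by (rule integral_abs_bound)
  finally have dm: "\<bar>(\<integral>z. h z \<partial>\<mu>) - (\<integral>z. ?f z \<partial>\<mu>)\<bar> \<le> m" .
  have m0: "0 \<le> m" using dm by linarith
  have "ereal (m / K) \<le> enn2ereal (\<integral>\<^sup>+x. ?L x \<partial>\<rho>)"
    using le m0 K by (metis divide_nonneg_pos enn2ereal_ennreal less_eq_ennreal.rep_eq)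
  then have "ereal K * ereal (m / K) \<le> ereal K * enn2ereal (\<integral>\<^sup>+x. ?L x \<partial>\<rho>)"
    using K by (intro ereal_mult_left_mono) auto
  moreover have "ereal K * ereal (m / K) = ereal m" using K by simp
  ultimately have "ereal m \<le> ereal K * enn2ereal (\<integral>\<^sup>+x. ?L x \<partial>\<rho>)" by simp
  with dm show ?thesis by (meson ereal_less_eq(3) order_trans)
qed

end

section \<open>The concrete model with the \<open>l1_norm\<close> distance\<close>

lemma sets_borel_on_finite:
  fixes U :: "'u::metric_space set"
  assumes "finite U"
  shows "sets (borel_on U) = Pow U"
proof
  show "sets (borel_on U) \<subseteq> Pow U" by (auto simp: sets_restrict_space)
  show "Pow U \<subseteq> sets (borel_on U)"
  proof
    fix D assume "D \<in> Pow U"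
    then have D: "D \<subseteq> U" by simp
    then have "D \<in> sets borel"
      using assms by (intro borel_closed finite_imp_closed) (rule finite_subset)
    then show "D \<in> sets (borel_on U)" using D by (auto simp: sets_restrict_space image_iff intro!: bexI[of _ D])
  qed
qed

lemma l1_norm_nonneg: "0 \<le> l1_norm x"
  by (simp add: l1_norm_def sum_nonneg)

lemma l1_norm_diff_measurable: "(\<lambda>x'. l1_norm (x - x')) \<in> borel_measurable (borel_on X)"
proof -
  have "continuous_on X (\<lambda>x'. l1_norm (x - x'))"
    unfolding l1_norm_def by (intro continuous_intros)
  then show ?thesis by (rule borel_measurable_continuous_on_restrict)
qed

theorem theorem2p7:
  fixes X :: "(real ^ 'n) set" and U :: "'u::metric_space set"
    and T :: "real ^ 'n \<Rightarrow> 'u \<Rightarrow> (real ^ 'n) measure"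
    and c :: "real ^ 'n \<Rightarrow> 'u \<Rightarrow> real"
    and \<alpha>\<^sub>c \<alpha>\<^sub>T :: real
    and \<mu> \<pi> :: "(real ^ 'n) measure"
    and M :: nat and B :: "nat \<Rightarrow> (real ^ 'n) set" and y :: "nat \<Rightarrow> real ^ 'n"
  assumes X: "X \<in> sets borel"
    and kernel: "(\<lambda>(x, u). T x u) \<in> borel_on X \<Otimes>\<^sub>M borel_on U \<rightarrow>\<^sub>M prob_algebra (borel_on X)"
    and U: "compact U" "finite U" "U \<noteq> {}"
    and c_nonneg: "\<forall>x\<in>X. \<forall>u\<in>U. 0 \<le> c x u"
    and c_bounded: "\<exists>K. \<forall>x\<in>X. \<forall>u\<in>U. \<bar>c x u\<bar> \<le> K"
    and c_cont: "continuous_on (X \<times> U) (\<lambda>(x, u). c x u)"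
    and weak_Feller: "\<forall>g :: real ^ 'n \<Rightarrow> real. continuous_on X g \<and> bounded (g ` X) \<longrightarrow>
           continuous_on (X \<times> U) (\<lambda>(x, u). \<integral>x\<^sub>1. g x\<^sub>1 \<partial>T x u)"
    and \<alpha>: "0 < \<alpha>\<^sub>c" "0 < \<alpha>\<^sub>T"
    and c_Lipschitz: "\<forall>x\<in>X. \<forall>x'\<in>X. \<forall>u\<in>U. \<bar>c x u - c x' u\<bar> \<le> \<alpha>\<^sub>c * l1_norm (x - x')"
    and T_Lipschitz: "\<forall>x\<in>X. \<forall>x'\<in>X. \<forall>u\<in>U.
           tv_norm (T x u) (T x' u) \<le> ennreal (\<alpha>\<^sub>T * l1_norm (x - x'))"
    and \<mu>: "sets \<mu> = sets (borel_on X)" "emeasure \<mu> X \<noteq> 0"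
    and minorization: "\<forall>x\<in>X. \<forall>u\<in>U. \<forall>D\<in>sets (borel_on X). emeasure \<mu> D \<le> emeasure (T x u) D"
    and bins: "\<forall>i\<in>{1..M}. B i \<in> sets (borel_on X)" "disjoint_family_on B {1..M}"
           "(\<Union>i\<in>{1..M}. B i) = X"
    and reps: "\<forall>i\<in>{1..M}. y i \<in> B i"
    and \<pi>: "sets \<pi> = sets (borel_on X)" "prob_space \<pi>" "\<forall>i\<in>{1..M}. 0 < emeasure \<pi> (B i)"
  shows "\<exists>j jhat :: real.
    (\<forall>x\<in>X. opt_avg_cost (borel_on X) (borel_on U) T c x = ereal j) \<and>
    (\<forall>x\<in>X. fin_opt_avg_cost M B y \<pi> (borel_on U) T c x = ereal jhat) \<and>
    (\<forall>h hh \<gamma>\<^sub>s \<rho>.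
       rel_value (borel_on X) U T c \<mu> h \<and>
       fin_rel_value M B y \<pi> U T c \<mu> hh \<and>
       \<gamma>\<^sub>s \<in> borel_on X \<rightarrow>\<^sub>M borel_on U \<and>
       (\<forall>x\<in>X. (\<integral>x\<^sub>1. \<bar>h x\<^sub>1 - hh (quantizer M B y x\<^sub>1)\<bar> \<partial>T x (\<gamma>\<^sub>s x)) =
          (SUP u\<in>U. \<integral>x\<^sub>1. \<bar>h x\<^sub>1 - hh (quantizer M B y x\<^sub>1)\<bar> \<partial>T x u)) \<and>
       invariant_prob (borel_on X) T \<gamma>\<^sub>s \<rho> \<longrightarrow>
       (\<forall>x\<^sub>0\<in>X.
          \<bar>opt_avg_cost (borel_on X) (borel_on U) T c x\<^sub>0
            - fin_opt_avg_cost M B y \<pi> (borel_on U) T c x\<^sub>0\<bar>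
          \<le> ereal (\<alpha>\<^sub>c + \<alpha>\<^sub>T * (SUP (x, u)\<in>X \<times> U. \<bar>c x u\<bar>) / measure \<mu> X)
             * enn2ereal (\<integral>\<^sup>+x. loss M B \<pi> x \<partial>\<rho>)))"
proof -
  let ?S = "borel_on X" and ?A = "borel_on U"
  have spS: "space ?S = X" and spA: "space ?A = U" by (simp_all add: space_restrict_space)
  have setsA: "sets ?A = Pow U" by (rule sets_borel_on_finite[OF U(2)])
  \<comment> \<open>Continuity makes each section measurable in the state; as \<open>U\<close> is
    finite and discrete, joint measurability follows.\<close>
  have cost: "(\<lambda>(x, u). c x u) \<in> borel_measurable (?S \<Otimes>\<^sub>M ?A)"
  proof -
    have "continuous_on X (\<lambda>x. c x u)" if "u \<in> U" for u
    proof -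
      have "continuous_on X (\<lambda>x. case (x, u) of (x, u) \<Rightarrow> c x u)"
        by (rule continuous_on_compose2[OF c_cont]) (use that in \<open>auto intro!: continuous_intros\<close>)
      then show ?thesis by simp
    qed
    then have "(\<lambda>(u, x). c x u) \<in> borel_measurable (count_space U \<Otimes>\<^sub>M ?S)"
      using U(2) by (intro measurable_pair_measure_countable1 countable_finite)
        (auto intro: borel_measurable_continuous_on_restrict)
    from measurable_pair_swap[OF this]
    have "(\<lambda>(x, u). c x u) \<in> borel_measurable (?S \<Otimes>\<^sub>M count_space U)" by simp
    moreover have "sets (?S \<Otimes>\<^sub>M ?A) = sets (?S \<Otimes>\<^sub>M count_space U)"
      by (rule sets_pair_measure_cong) (simp_all add: setsA)
    ultimately show ?thesis by (simp cong: measurable_cong_sets)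
  qed
  interpret \<pi>: prob_space \<pi> by (rule \<pi>(2))
  interpret quantized_mdp ?S ?A T c \<mu> \<pi> M B y
  proof
    show "(\<lambda>(x, u). T x u) \<in> ?S \<Otimes>\<^sub>M ?A \<rightarrow>\<^sub>M prob_algebra ?S" by (rule kernel)
    show "(\<lambda>(x, u). c x u) \<in> borel_measurable (?S \<Otimes>\<^sub>M ?A)" by (rule cost)
    show "sets ?A = Pow (space ?A)" unfolding setsA spA ..
    show "disjoint_family_on B {1..M}" by (rule bins(2))
  qed (use c_bounded U \<mu> minorization \<pi> bins reps in \<open>auto simp: spS spA simp del: One_nat_def atLeastAtMost_iff\<close>)
  obtain x\<^sub>1 u\<^sub>1 where xu1: "x\<^sub>1 \<in> X" "u\<^sub>1 \<in> U" using \<mu>(2) U(3) by fastforce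
  define C where "C = (SUP (x, u)\<in>X \<times> U. \<bar>c x u\<bar>)"
  have C: "\<bar>c x u\<bar> \<le> C" if "x \<in> X" "u \<in> U" for x u
  proof -
    \<comment> \<open>A real supremum dominates its family only when the family is bounded
      above.\<close>
    obtain L where "\<forall>x\<in>X. \<forall>u\<in>U. \<bar>c x u\<bar> \<le> L" using c_bounded by blast
    then have "bdd_above ((\<lambda>(x, u). \<bar>c x u\<bar>) ` (X \<times> U))"
      by (auto intro!: bdd_aboveI[of _ L])
    then show ?thesis
      unfolding C_def using cSUP_upper[of "(x, u)" "X \<times> U" "\<lambda>(x, u). \<bar>c x u\<bar>"] that by simp
  qed
  have C0: "0 \<le> C" using C[OF xu1] by simp
  have c_range: "0 \<le> c x u \<and> c x u \<le> C" if "x \<in> space ?S" "u \<in> space ?A" for x u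
    using c_nonneg C[of x u] that by (simp add: spS spA abs_le_iff)
  have finc_range: "0 \<le> finc z u \<and> finc z u \<le> C" if "z \<in> space (count_space Y)" "u \<in> space ?A" for z u
  proof
    have z: "z \<in> space ?S" using that Y_space by simp
    show "0 \<le> finc z u"
      unfolding fin_cost_eq[OF z that(2)] using c_range that(2)
      by (intro Bochner_Integration.integral_nonneg) (simp add: space_bin_weight[OF z])
    show "finc z u \<le> C"
      using fin_cost_le[OF z that(2), of C] C that(2) by (simp add: spS spA)
  qed
  have opt: "opt_avg_cost ?S ?A T c x = ereal (\<integral>z. h z \<partial>\<mu>)" if "rel_value ?S U T c \<mu> h" "x \<in> X" for h x
    using opt_avg_cost_rel_value[of h x] that by (simp add: spS spA)
  have fin_opt: "fin_opt_avg_cost M B y \<pi> ?A T c x = ereal (\<integral>z. hh (q z) \<partial>\<mu>)"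
    if "fin_rel_value M B y \<pi> U T c \<mu> hh" "x \<in> X" for hh x
    using fin.opt_avg_cost_rel_value[of hh "q x"] that quantizer_in[of x] fin_rel_value_iff[of hh] integral_minorY[of hh]
    by (simp add: spS spA fin_opt_avg_cost_def)
  obtain h\<^sub>0 where h0: "rel_value ?S U T c \<mu> h\<^sub>0"
    using rel_value_exists[OF c_range] by (auto simp: spA)
  obtain hh\<^sub>0 where hh0: "fin_rel_value M B y \<pi> U T c \<mu> hh\<^sub>0"
    using fin.rel_value_exists[OF finc_range] fin_rel_value_iff by (auto simp: spA)
  have mass: "mass = measure \<mu> X" by (simp add: mass_def spS)
  \<comment> \<open>The Lipschitz constant in the state of the Bellman expression for
    \<open>hh (q z)\<close>: \<open>\<alpha>\<^sub>c\<close> from the cost, and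
    \<open>\<alpha>\<^sub>T\<close> times the bound on \<open>hh\<close> from the kernel.\<close>
  define K where "K = \<alpha>\<^sub>c + \<alpha>\<^sub>T * C / measure \<mu> X"
  have K: "0 < K" unfolding K_def
    using \<alpha> C0 mass_pos by (intro add_pos_nonneg) (auto simp: mass)
  have bound: "\<bar>opt_avg_cost ?S ?A T c x\<^sub>0 - fin_opt_avg_cost M B y \<pi> ?A T c x\<^sub>0\<bar>
      \<le> ereal K * enn2ereal (\<integral>\<^sup>+x. loss M B \<pi> x \<partial>\<rho>)"
    if h: "rel_value ?S U T c \<mu> h" and hh: "fin_rel_value M B y \<pi> U T c \<mu> hh"
      and \<phi>: "\<phi> \<in> ?S \<rightarrow>\<^sub>M ?A"
      and sup: "\<forall>x\<in>X. (\<integral>z. \<bar>h z - hh (q z)\<bar> \<partial>T x (\<phi> x)) = (SUP u\<in>U. \<integral>z. \<bar>h z - hh (q z)\<bar> \<partial>T x u)"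
      and inv: "invariant_prob ?S T \<phi> \<rho>" and x\<^sub>0: "x\<^sub>0 \<in> X" for h hh \<phi> \<rho> x\<^sub>0
  proof -
    have rhh: "rel_value (count_space Y) (space ?A) finT finc minorY hh"
      using hh fin_rel_value_iff[of hh] by (simp add: spA)
    have hb: "\<bar>hh (q z)\<bar> \<le> C / mass" if "z \<in> X" for z
      unfolding fin_mass[symmetric]
    proof (rule fin.rel_value_bound[OF rhh])
      show "q z \<in> space (count_space Y)" using quantizer_in[of z] that by (simp add: spS)
      show "\<bar>finc z u\<bar> \<le> C" if "z \<in> space (count_space Y)" "u \<in> space ?A" for z u
        using finc_range[OF that] by simp
    qed
    have Lip: "\<bar>bellman (\<lambda>z. hh (q z)) x u - bellman (\<lambda>z. hh (q z)) x' u\<bar> \<le> K * l1_norm (x - x')"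
      if x: "x \<in> X" and x': "x' \<in> X" and u: "u \<in> U" for x x' u
    proof -
      have sxu: "sets (T x u) = sets ?S" and spxu: "space (T x u) = X" and spx'u: "space (T x' u) = X"
        using sets_kernel[of x u] space_kernel[of x u] space_kernel[of x' u] x x' u by (auto simp: spS spA)
      \<comment> \<open>The extended \<open>hh\<close> may jump between bins, so regularity in the
        state comes from the total variation bound on \<open>T\<close>.\<close>
      have "\<bar>(\<integral>z. hh (q z) \<partial>T x u) - (\<integral>z. hh (q z) \<partial>T x' u)\<bar> \<le> C / mass * (\<alpha>\<^sub>T * l1_norm (x - x'))"
      proof (rule tv_norm_integral_le)
        show "(\<lambda>z. hh (q z)) \<in> borel_measurable (T x u)"
          unfolding measurable_cong_sets[OF sxu refl] by (rule quantizer_compose_measurable)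
        show "tv_norm (T x u) (T x' u) \<le> ennreal (\<alpha>\<^sub>T * l1_norm (x - x'))"
          using T_Lipschitz x x' u by blast
        show "0 \<le> \<alpha>\<^sub>T * l1_norm (x - x')"
          using \<alpha>(2) l1_norm_nonneg[of "x - x'"] by simp
      qed (use hb C0 mass_pos in \<open>auto simp: spxu spx'u\<close>)
      moreover have "\<bar>c x u - c x' u\<bar> \<le> \<alpha>\<^sub>c * l1_norm (x - x')"
        using c_Lipschitz x x' u by blast
      moreover have "K * l1_norm (x - x') = \<alpha>\<^sub>c * l1_norm (x - x') + C / mass * (\<alpha>\<^sub>T * l1_norm (x - x'))"
        by (simp add: K_def mass algebra_simps)
      ultimately show ?thesis unfolding bellman_def by linarith
    qed
    have max: "(\<integral>z. \<bar>h z - hh (q z)\<bar> \<partial>T x u) \<le> (\<integral>z. \<bar>h z - hh (q z)\<bar> \<partial>T x (\<phi> x))"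
      if "x \<in> X" "u \<in> U" for x u
      unfolding sup[rule_format, OF that(1)] using that(2) U(2)
      by (intro cSUP_upper) (auto intro!: bounded_imp_bdd_above finite_imp_bounded)
    have "ereal \<bar>(\<integral>z. h z \<partial>\<mu>) - (\<integral>z. hh (q z) \<partial>\<mu>)\<bar>
        \<le> ereal K * enn2ereal (\<integral>\<^sup>+x. (\<integral>\<^sup>+x'\<in>bin_of M B x. ennreal (l1_norm (x - x')) \<partial>W x) \<partial>\<rho>)"
      by (rule average_cost_error[OF _ _ \<phi> _ inv K l1_norm_diff_measurable])
        (use h hh max Lip in \<open>simp_all add: spS spA\<close>)
    then show ?thesis
      unfolding opt[OF h x\<^sub>0] fin_opt[OF hh x\<^sub>0] loss_def[abs_def] by simp
  qed
  \<comment> \<open>The constants come from the particular solutions \<open>h\<^sub>0\<close> and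
    \<open>hh\<^sub>0\<close>; \<open>bound\<close> expresses the same optimal costs through
    whichever solutions it is given.\<close>
  show ?thesis
    unfolding C_def[symmetric] K_def[symmetric]
  proof (rule exI[of _ "\<integral>z. h\<^sub>0 z \<partial>\<mu>"], rule exI[of _ "\<integral>z. hh\<^sub>0 (q z) \<partial>\<mu>"],
      intro conjI ballI allI impI)
    show "opt_avg_cost ?S ?A T c x = ereal (\<integral>z. h\<^sub>0 z \<partial>\<mu>)" if "x \<in> X" for x
      by (rule opt[OF h0 that])
    show "fin_opt_avg_cost M B y \<pi> ?A T c x = ereal (\<integral>z. hh\<^sub>0 (q z) \<partial>\<mu>)" if "x \<in> X" for x
      by (rule fin_opt[OF hh0 that])
  qed (elim conjE, rule bound)
qed

end
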